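(* Refutability of blocks in $\mathsf{BT}^{i}$, and hence derivability of sequents in $\mathsf{G3T}^{i}$ and provability of formulae in intuitionistic propositional logic, is decidable.
   Context: Formulae are generated from a countable set of propositional variables by $A ::= p \mid \bot \mid A\land A \mid A\lor A \mid A\to A$. Blocks. A signed formula is $\mathsf{T}A$ or $\mathsf{F}A$; a block is a finite set $\Pi$ of signed formulae; $\Pi^{\mathsf{T}}=\{\mathsf{T}A:\mathsf{T}A\in\Pi\}$. The calculus $\mathsf{BT}^{i}$. A block is closed if it contains $\mathsf{T}p$ and $\mathsf{F}p$ for some propositional variable $p$, or contains $\mathsf{T}\bot$. The rules pass from a block (context $\Pi$ plus displayed principal formula, which is removed unless displayed again) to one or two children: - $\mathsf{T}\land$: from $\Pi,\mathsf{T}(A\land B)$ to $\Pi,\mathsf{T}A,\mathsf{T}B$. - $\mathsf{F}\lor$: from $\Pi,\mathsf{F}(A\lor B)$ to $\Pi,\mathsf{F}A,\mathsf{F}B$. - $\mathsf{T}\lor$: from $\Pi,\mathsf{T}(A\lor B)$ to two children $\Pi,\mathsf{T}A$ and $\Pi,\mathsf{T}B$. - $\mathsf{F}\land$: from $\Pi,\mathsf{F}(A\land B)$ to two children $\Pi,\mathsf{F}A$ and $\Pi,\mathsf{F}B$. - $\mathsf{T}\to$: from $\Pi,\mathsf{T}(A\to B)$ to two children $\Pi,\mathsf{T}(A\to B),\mathsf{F}A$ and $\Pi,\mathsf{T}B$. - $\mathsf{F}\to$: from $\Pi,\mathsf{F}(A\to B)$ to $\Pi^{\mathsf{T}},\mathsf{T}A,\mathsf{F}B$.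 A tableau for $\Pi$ is a finite tree rooted at $\Pi$ grown by these rules; it is closed if every leaf is a closed block. $\Pi$ is refutable if it has a closed tableau. The calculus $\mathsf{G3T}^{i}$. Sequents $\Gamma\Rightarrow\Delta$ have $\Gamma,\Delta$ finite multisets of formulae. Initial sequents: $p,\Gamma\Rightarrow\Delta,p$ ($p$ a variable) and $\bot,\Gamma\Rightarrow\Delta$. Rules (premisses / conclusion): - $\land\mathrm L$: $A,B,\Gamma\Rightarrow\Delta$ / $A\land B,\Gamma\Rightarrow\Delta$. - $\lor\mathrm L$: $A,\Gamma\Rightarrow\Delta$ and $B,\Gamma\Rightarrow\Delta$ / $A\lor B,\Gamma\Rightarrow\Delta$. - $\to\!\mathrm L$: $A\to B,\Gamma\Rightarrow\Delta,A$ and $B,\Gamma\Rightarrow\Delta$ / $A\to B,\Gamma\Rightarrow\Delta$. - $\land\mathrm R$: $\Gamma\Rightarrow\Delta,A$ and $\Gamma\Rightarrow\Delta,B$ / $\Gamma\Rightarrow\Delta,A\land B$. - $\lor\mathrm R$: $\Gamma\Rightarrow\Delta,A,B$ / $\Gamma\Rightarrow\Delta,A\lor B$. - $\to\!\mathrm R$: $A,\Gamma\Rightarrow B$ / $\Gamma\Rightarrow\Delta,A\to B$. *)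

theory Defs
  imports "HOL-Library.Nat_Bijection" "HOL-Library.Multiset"
begin

section \<open>Formulae, signed formulae, blocks\<close>

datatype form =
    Var nat
  | Bot
  | And form form
  | Or form form
  | Imp form form

datatype sform = T form | F form

type_synonym block = "sform set"

definition T_part :: "block \<Rightarrow> block" where
  "T_part \<Pi> = {\<phi> \<in> \<Pi>. \<exists>A. \<phi> = T A}"


section \<open>The block tableau calculus\<close>

definition closed_block :: "block \<Rightarrow> bool" where
  "closed_block \<Pi> \<longleftrightarrow> (\<exists>p. T (Var p) \<in> \<Pi> \<and> F (Var p) \<in> \<Pi>) \<or> T Bot \<in> \<Pi>"

text \<open>
  The second argument lists the children. Blocks are sets, so the side conditions
  make \<open>\<Pi>\<close> the block without its principal formula: the latter is removed
  unless the rule displays it again.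
\<close>

inductive BTi_rule :: "block \<Rightarrow> block list \<Rightarrow> bool" where
  TAnd: "T (And A B) \<notin> \<Pi> \<Longrightarrow>
    BTi_rule (insert (T (And A B)) \<Pi>) [insert (T A) (insert (T B) \<Pi>)]"
| FOr: "F (Or A B) \<notin> \<Pi> \<Longrightarrow>
    BTi_rule (insert (F (Or A B)) \<Pi>) [insert (F A) (insert (F B) \<Pi>)]"
| TOr: "T (Or A B) \<notin> \<Pi> \<Longrightarrow>
    BTi_rule (insert (T (Or A B)) \<Pi>) [insert (T A) \<Pi>, insert (T B) \<Pi>]"
| FAnd: "F (And A B) \<notin> \<Pi> \<Longrightarrow>
    BTi_rule (insert (F (And A B)) \<Pi>) [insert (F A) \<Pi>, insert (F B) \<Pi>]"
| TImp: "T (Imp A B) \<notin> \<Pi> \<Longrightarrow>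
    BTi_rule (insert (T (Imp A B)) \<Pi>)
      [insert (T (Imp A B)) (insert (F A) \<Pi>), insert (T B) \<Pi>]"
| FImp: "F (Imp A B) \<notin> \<Pi> \<Longrightarrow>
    BTi_rule (insert (F (Imp A B)) \<Pi>) [insert (T A) (insert (F B) (T_part \<Pi>))]"

datatype btree = Node (root: block) (children: "btree list")

inductive tableau :: "btree \<Rightarrow> bool" where
  leaf: "tableau (Node \<Pi> [])"
| expand: "BTi_rule \<Pi> (map root ts) \<Longrightarrow> (\<forall>t \<in> set ts. tableau t) \<Longrightarrow> tableau (Node \<Pi> ts)"

primrec leaves :: "btree \<Rightarrow> block set" where
  "leaves (Node \<Pi> ts) = (if ts = [] then {\<Pi>} else \<Union> (set (map leaves ts)))"

definition refutable :: "block \<Rightarrow> bool" where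
  "refutable \<Pi> \<longleftrightarrow>
     (\<exists>t. tableau t \<and> root t = \<Pi> \<and> (\<forall>\<Sigma> \<in> leaves t. closed_block \<Sigma>))"


section \<open>The sequent calculus\<close>

inductive G3Ti :: "form multiset \<Rightarrow> form multiset \<Rightarrow> bool" where
  Ax: "G3Ti (add_mset (Var p) \<Gamma>) (add_mset (Var p) \<Delta>)"
| BotL: "G3Ti (add_mset Bot \<Gamma>) \<Delta>"
| AndL: "G3Ti (add_mset A (add_mset B \<Gamma>)) \<Delta> \<Longrightarrow> G3Ti (add_mset (And A B) \<Gamma>) \<Delta>"
| OrL: "G3Ti (add_mset A \<Gamma>) \<Delta> \<Longrightarrow> G3Ti (add_mset B \<Gamma>) \<Delta> \<Longrightarrow>
    G3Ti (add_mset (Or A B) \<Gamma>) \<Delta>"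
| ImpL: "G3Ti (add_mset (Imp A B) \<Gamma>) (add_mset A \<Delta>) \<Longrightarrow> G3Ti (add_mset B \<Gamma>) \<Delta> \<Longrightarrow>
    G3Ti (add_mset (Imp A B) \<Gamma>) \<Delta>"
| AndR: "G3Ti \<Gamma> (add_mset A \<Delta>) \<Longrightarrow> G3Ti \<Gamma> (add_mset B \<Delta>) \<Longrightarrow>
    G3Ti \<Gamma> (add_mset (And A B) \<Delta>)"
| OrR: "G3Ti \<Gamma> (add_mset A (add_mset B \<Delta>)) \<Longrightarrow> G3Ti \<Gamma> (add_mset (Or A B) \<Delta>)"
| ImpR: "G3Ti (add_mset A \<Gamma>) {#B#} \<Longrightarrow> G3Ti \<Gamma> (add_mset (Imp A B) \<Delta>)"


section \<open>Intuitionistic propositional logic\<close>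

text \<open>
  Gentzen's natural deduction system NJ, with \<open>\<Gamma>\<close> the set of available assumptions.
  Provability in the logic is thus defined independently of the two calculi above.
\<close>

inductive NJ :: "form set \<Rightarrow> form \<Rightarrow> bool" where
  Assm: "A \<in> \<Gamma> \<Longrightarrow> NJ \<Gamma> A"
| BotE: "NJ \<Gamma> Bot \<Longrightarrow> NJ \<Gamma> A"
| AndI: "NJ \<Gamma> A \<Longrightarrow> NJ \<Gamma> B \<Longrightarrow> NJ \<Gamma> (And A B)"
| AndE1: "NJ \<Gamma> (And A B) \<Longrightarrow> NJ \<Gamma> A"
| AndE2: "NJ \<Gamma> (And A B) \<Longrightarrow> NJ \<Gamma> B"
| OrI1: "NJ \<Gamma> A \<Longrightarrow> NJ \<Gamma> (Or A B)"
| OrI2: "NJ \<Gamma> B \<Longrightarrow> NJ \<Gamma> (Or A B)"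
| OrE: "NJ \<Gamma> (Or A B) \<Longrightarrow> NJ (insert A \<Gamma>) C \<Longrightarrow> NJ (insert B \<Gamma>) C \<Longrightarrow> NJ \<Gamma> C"
| ImpI: "NJ (insert A \<Gamma>) B \<Longrightarrow> NJ \<Gamma> (Imp A B)"
| ImpE: "NJ \<Gamma> (Imp A B) \<Longrightarrow> NJ \<Gamma> A \<Longrightarrow> NJ \<Gamma> B"

definition IPL_provable :: "form \<Rightarrow> bool" where
  "IPL_provable A \<longleftrightarrow> NJ {} A"


section \<open>Recursive functions and decidable sets of natural numbers\<close>

text \<open>
  \<open>recursive n f\<close>: the total function \<open>f\<close> of \<open>n\<close> arguments is (general) recursive.
  The arguments are passed as a list; only the values of \<open>f\<close> on lists of length \<open>n\<close>
  are meaningful. Minimisation is restricted to regular functions, so exactly the total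
  recursive functions are generated.
\<close>

inductive recursive :: "nat \<Rightarrow> (nat list \<Rightarrow> nat) \<Rightarrow> bool" where
  zero: "recursive n (\<lambda>xs. 0)"
| succ: "recursive 1 (\<lambda>xs. Suc (xs ! 0))"
| proj: "i < n \<Longrightarrow> recursive n (\<lambda>xs. xs ! i)"
| comp: "recursive (length gs) f \<Longrightarrow> (\<forall>g \<in> set gs. recursive n g) \<Longrightarrow>
    recursive n (\<lambda>xs. f (map (\<lambda>g. g xs) gs))"
| prec: "recursive n f \<Longrightarrow> recursive (Suc (Suc n)) g \<Longrightarrow>
    recursive (Suc n) (\<lambda>xs. rec_nat (f (tl xs)) (\<lambda>k r. g (k # r # tl xs)) (hd xs))"
| minim: "recursive (Suc n) f \<Longrightarrow> (\<forall>xs. length xs = n \<longrightarrow> (\<exists>y. f (y # xs) = 0)) \<Longrightarrow>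
    recursive n (\<lambda>xs. LEAST y. f (y # xs) = 0)"

definition decidable_set :: "nat set \<Rightarrow> bool" where
  "decidable_set S \<longleftrightarrow>
     (\<exists>f. recursive 1 f \<and> (\<forall>n. f [n] = (if n \<in> S then 1 else 0)))"


section \<open>Goedel numbering\<close>

primrec form_code :: "form \<Rightarrow> nat" where
  "form_code Bot = 0"
| "form_code (Var p) = 4 * p + 1"
| "form_code (And A B) = 4 * prod_encode (form_code A, form_code B) + 2"
| "form_code (Or A B) = 4 * prod_encode (form_code A, form_code B) + 3"
| "form_code (Imp A B) = 4 * prod_encode (form_code A, form_code B) + 4"

primrec sform_code :: "sform \<Rightarrow> nat" where
  "sform_code (T A) = 2 * form_code A"
| "sform_code (F A) = 2 * form_code A + 1"

text \<open>A finite set of numbers is coded by the number whose binary digits are its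
  characteristic function. The code is meaningful only for finite blocks.\<close>

definition block_code :: "block \<Rightarrow> nat" where
  "block_code \<Pi> = set_encode (sform_code ` \<Pi>)"

text \<open>A multiset is coded through the sorted list of the codes of its members.\<close>

definition mset_code :: "form multiset \<Rightarrow> nat" where
  "mset_code \<Gamma> = list_encode (sorted_list_of_multiset (image_mset form_code \<Gamma>))"

definition sequent_code :: "form multiset \<Rightarrow> form multiset \<Rightarrow> nat" where
  "sequent_code \<Gamma> \<Delta> = prod_encode (mset_code \<Gamma>, mset_code \<Delta>)"

lemma form_code_inject [simp]: "form_code A = form_code B \<longleftrightarrow> A = B"
proof
  show "form_code A = form_code B \<Longrightarrow> A = B"
  proof (induction A arbitrary: B)
    case (Var p) then show ?case by (cases B; simp; presburger)
  next
    case Bot then show ?case by (cases B) simp_all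
  next
    case (And A1 A2) then show ?case by (cases B; simp; presburger)
  next
    case (Or A1 A2) then show ?case by (cases B; simp; presburger)
  next
    case (Imp A1 A2) then show ?case by (cases B; simp; presburger)
  qed
qed simp

lemma sform_code_inject [simp]: "sform_code \<phi> = sform_code \<psi> \<longleftrightarrow> \<phi> = \<psi>"
  by (cases \<phi>; cases \<psi>; simp; presburger)

lemma inj_on_block_code: "inj_on block_code {\<Pi>. finite \<Pi>}"
proof (rule inj_onI)
  fix \<Pi> \<Sigma> :: block
  assume fin: "\<Pi> \<in> {\<Pi>. finite \<Pi>}" "\<Sigma> \<in> {\<Pi>. finite \<Pi>}"
    and eq: "block_code \<Pi> = block_code \<Sigma>"
  from fin eq have "sform_code ` \<Pi> = sform_code ` \<Sigma>"
    by (simp add: block_code_def set_encode_eq)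
  moreover have "inj sform_code" by (simp add: inj_def)
  ultimately show "\<Pi> = \<Sigma>" by (simp add: inj_image_eq_iff)
qed

lemma mset_code_inject: "mset_code \<Gamma> = mset_code \<Delta> \<longleftrightarrow> \<Gamma> = \<Delta>"
proof
  assume "mset_code \<Gamma> = mset_code \<Delta>"
  then have "sorted_list_of_multiset (image_mset form_code \<Gamma>)
      = sorted_list_of_multiset (image_mset form_code \<Delta>)"
    by (simp add: mset_code_def list_encode_eq)
  then have "image_mset form_code \<Gamma> = image_mset form_code \<Delta>"
    by (metis mset_sorted_list_of_multiset)
  moreover have "inj form_code" by (simp add: inj_def)
  ultimately show "\<Gamma> = \<Delta>" by (metis multiset.inj_map injD)
qed simp

lemma sequent_code_inject:
  "sequent_code \<Gamma> \<Delta> = sequent_code \<Gamma>' \<Delta>' \<longleftrightarrow> \<Gamma> = \<Gamma>' \<and> \<Delta> = \<Delta>'"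
  by (simp add: sequent_code_def mset_code_inject)

end

theory Submission
  imports Defs
begin

text \<open>
  Backward application of a tableau rule never leaves the subformulae of the root, so the search for
  a refutation of a finite block moves inside a finite set of blocks. More crudely, components have
  smaller Goedel numbers than the formula itself, so that if \<open>n\<close> is the code of the
  root then every block that occurs has a code below \<open>2 ^ (2 * n)\<close>
  (\<open>BTi_rule_universe\<close>, \<open>block_code_less_iff\<close>). The refutable blocks form
  the least set that contains the closed blocks and contains the conclusion of a rule once it
  contains the children. Restricted to blocks with codes below that bound, this least fixed point is
  the intersection of all sets of codes below \<open>2 ^ (2 * n)\<close> with this property, and a
  set of such codes is again a number, below \<open>2 ^ 2 ^ (2 * n)\<close>. Refutability is thereby
  a formula with bounded quantifiers only (\<open>refutable_code_iff\<close>), and such formulae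
  have recursive characteristic functions because bounded sums do (\<open>computable_sum\<close>,
  \<open>computable_rel_bex\<close>).

  The other two problems reduce to this one by recursive maps on codes (numbers that code no
  sequent, because one of their two lists is not sorted, are recognised separately), since a sequent
  \<open>\<Gamma> \<Rightarrow> \<Delta>\<close> is derivable iff the block of all \<open>T
  A\<close> with \<open>A\<close> in \<open>\<Gamma>\<close> and all \<open>F B\<close> with
  \<open>B\<close> in \<open>\<Delta>\<close> is refutable, and a formula \<open>A\<close> is
  provable iff the block \<open>{F A}\<close> is. A refutation translates into a derivation in
  either system (\<open>refutable_imp_G3Ti\<close>, \<open>refutable_imp_NJ\<close>) by an induction
  that carries an arbitrary superset of the block, respectively an arbitrary context proving its
  \<open>T\<close>-formulae; this form of the induction hypothesis absorbs all weakenings and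
  contractions. The converse is semantic: both systems are sound for Kripke models, and an
  unrefutable finite block has a Kripke countermodel (\<open>BTi_complete\<close>).
\<close>


section \<open>Closure properties of recursive functions and relations\<close>

text \<open>
  Only the values on lists of length \<open>n\<close> have a meaning, whereas \<open>recursive n
  f\<close> also fixes the values of \<open>f\<close> elsewhere. Closing the predicate under
  equality on lists of length \<open>n\<close> makes it invariant under rewriting of
  \<open>f\<close>.
\<close>

definition computable :: "nat \<Rightarrow> (nat list \<Rightarrow> nat) \<Rightarrow> bool" where
  "computable n f \<longleftrightarrow> (\<exists>g. recursive n g \<and> (\<forall>xs. length xs = n \<longrightarrow> g xs = f xs))"

definition computable_rel :: "nat \<Rightarrow> (nat list \<Rightarrow> bool) \<Rightarrow> bool" where
  "computable_rel n P \<longleftrightarrow> computable n (\<lambda>xs. if P xs then 1 else 0)"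

lemma computable_cong:
  assumes "computable n f" "\<And>xs. length xs = n \<Longrightarrow> f xs = g xs"
  shows "computable n g"
  using assms unfolding computable_def by metis

lemma computable_recursive: "recursive n f \<Longrightarrow> computable n f"
  unfolding computable_def by blast

lemma computable_comp:
  assumes "computable (length gs) f" "\<forall>g \<in> set gs. computable n g"
  shows "computable n (\<lambda>xs. f (map (\<lambda>g. g xs) gs))"
proof -
  obtain f' where f': "recursive (length gs) f'"
      "\<And>xs. length xs = length gs \<Longrightarrow> f' xs = f xs"
    using assms(1) unfolding computable_def by blast
  obtain h where h: "\<And>g. g \<in> set gs \<Longrightarrow> recursive n (h g)"
      "\<And>g xs. g \<in> set gs \<Longrightarrow> length xs = n \<Longrightarrow> h g xs = g xs"
    using assms(2) unfolding computable_def by metis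
  have "recursive n (\<lambda>xs. f' (map (\<lambda>g. g xs) (map h gs)))"
    by (rule recursive.comp) (use f'(1) h(1) in auto)
  moreover have "f' (map (\<lambda>g. g xs) (map h gs)) = f (map (\<lambda>g. g xs) gs)" if "length xs = n" for xs
  proof -
    have "map (\<lambda>g. g xs) (map h gs) = map (\<lambda>g. g xs) gs" using h(2) that by simp
    then show ?thesis using f'(2) by (metis length_map)
  qed
  ultimately show ?thesis unfolding computable_def by blast
qed

lemma computable_nth: "i < n \<Longrightarrow> computable n (\<lambda>xs. xs ! i)"
  by (rule computable_recursive, rule recursive.proj)

lemma computable_compose1:
  assumes "computable (Suc 0) (\<lambda>xs. f (hd xs))" "computable n a"
  shows "computable n (\<lambda>xs. f (a xs))"
  using computable_comp[of "[a]" "\<lambda>xs. f (hd xs)" n] assms by simp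

lemma computable_compose2:
  assumes "computable (Suc (Suc 0)) (\<lambda>xs. f (hd xs) (hd (tl xs)))" "computable n a" "computable n b"
  shows "computable n (\<lambda>xs. f (a xs) (b xs))"
  using computable_comp[of "[a, b]" "\<lambda>xs. f (hd xs) (hd (tl xs))" n] assms by simp

lemma computable_rel_compose1:
  assumes "computable_rel (Suc 0) (\<lambda>xs. P (hd xs))" "computable n a"
  shows "computable_rel n (\<lambda>xs. P (a xs))"
  using computable_compose1[of "\<lambda>x. if P x then 1 else 0"] assms unfolding computable_rel_def by simp

lemma computable_rel_compose2:
  assumes "computable_rel (Suc (Suc 0)) (\<lambda>xs. P (hd xs) (hd (tl xs)))" "computable n a" "computable n b"
  shows "computable_rel n (\<lambda>xs. P (a xs) (b xs))"
  using computable_compose2[of "\<lambda>x y. if P x y then 1 else 0"] assms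
  unfolding computable_rel_def by simp

lemma computable_tl:
  assumes "computable n f"
  shows "computable (Suc n) (\<lambda>xs. f (tl xs))"
proof -
  let ?gs = "map (\<lambda>i xs. xs ! Suc i) [0..<n]"
  have "computable (Suc n) (\<lambda>xs. f (map (\<lambda>g. g xs) ?gs))"
    by (rule computable_comp) (use assms in \<open>auto intro: computable_nth\<close>)
  then show ?thesis
  proof (rule computable_cong)
    fix xs :: "nat list" assume "length xs = Suc n"
    then have "map (\<lambda>g. g xs) ?gs = tl xs"
      by (intro nth_equalityI) (auto simp: nth_tl)
    then show "f (map (\<lambda>g. g xs) ?gs) = f (tl xs)" by simp
  qed
qed

text \<open>
  A function of several arguments is written with \<open>hd\<close> and \<open>tl\<close>, the first
  argument being the one bound innermost. Each rule below then reduces a term to its immediate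
  subterms by higher-order pattern unification, also under binders.
\<close>

lemma computable_arg0: "computable (Suc n) (\<lambda>xs. hd xs)"
  by (rule computable_cong[OF computable_nth[of 0]]) (auto simp: length_Suc_conv)

lemmas computable_arg1 = computable_tl[OF computable_arg0]
lemmas computable_arg2 = computable_tl[OF computable_arg1]
lemmas computable_arg3 = computable_tl[OF computable_arg2]
lemmas computable_arg4 = computable_tl[OF computable_arg3]

lemma computable_Suc: "computable n f \<Longrightarrow> computable n (\<lambda>xs. Suc (f xs))"
proof (rule computable_compose1[of Suc])
  show "computable (Suc 0) (\<lambda>xs. Suc (hd xs))"
    by (rule computable_cong[OF computable_recursive[OF recursive.succ[unfolded One_nat_def]]])
      (auto simp: length_Suc_conv)
qed

lemma computable_const: "computable n (\<lambda>xs. c)"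
  by (induction c) (auto intro: computable_Suc computable_recursive recursive.zero)

text \<open>
  The recursion may use all arguments of the function, so the bound \<open>t\<close> is substituted
  for the recursion variable and the remaining arguments are passed on by projections.
\<close>

lemma computable_rec_nat:
  assumes f: "computable n f"
    and g: "computable (Suc (Suc n)) (\<lambda>ys. g (hd ys) (hd (tl ys)) (tl (tl ys)))"
    and t: "computable n t"
  shows "computable n (\<lambda>xs. rec_nat (f xs) (\<lambda>k r. g k r xs) (t xs))"
proof -
  obtain f' where f': "recursive n f'" "\<And>xs. length xs = n \<Longrightarrow> f' xs = f xs"
    using f unfolding computable_def by blast
  obtain g' where g': "recursive (Suc (Suc n)) g'"
      "\<And>ys. length ys = Suc (Suc n) \<Longrightarrow> g' ys = g (hd ys) (hd (tl ys)) (tl (tl ys))"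
    using g unfolding computable_def by blast
  let ?h = "\<lambda>xs. rec_nat (f (tl xs)) (\<lambda>k r. g k r (tl xs)) (hd xs)"
  have "computable (Suc n) ?h"
  proof (rule computable_cong[OF computable_recursive[OF recursive.prec[OF f'(1) g'(1)]]])
    fix xs :: "nat list" assume xs: "length xs = Suc n"
    have "rec_nat (f' (tl xs)) (\<lambda>k r. g' (k # r # tl xs)) m
        = rec_nat (f (tl xs)) (\<lambda>k r. g k r (tl xs)) m" for m
      by (induction m) (use xs in \<open>simp_all add: f'(2) g'(2)\<close>)
    then show "rec_nat (f' (tl xs)) (\<lambda>k r. g' (k # r # tl xs)) (hd xs) = ?h xs" .
  qed
  moreover let ?gs = "t # map (\<lambda>i xs. xs ! i) [0..<n]"
  have "\<forall>g \<in> set ?gs. computable n g" using t by (auto intro: computable_nth)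
  ultimately have "computable n (\<lambda>xs. ?h (map (\<lambda>g. g xs) ?gs))"
    by (intro computable_comp) simp_all
  then show ?thesis
  proof (rule computable_cong)
    fix xs :: "nat list" assume "length xs = n"
    then have "map (\<lambda>g. g xs) (map (\<lambda>i xs. xs ! i) [0..<n]) = xs"
      by (intro nth_equalityI) auto
    then show "?h (map (\<lambda>g. g xs) ?gs) = rec_nat (f xs) (\<lambda>k r. g k r xs) (t xs)"
      by simp
  qed
qed

text \<open>
  A definition by cases is a recursion of length at most one.
\<close>

lemma computable_if:
  assumes "computable_rel n P" "computable n f" "computable n g"
  shows "computable n (\<lambda>xs. if P xs then f xs else g xs)"
proof -
  have "computable n (\<lambda>xs. rec_nat (g xs) (\<lambda>_ _. f xs) (if P xs then 1 else 0))"
    using assms unfolding computable_rel_def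
    by (intro computable_rec_nat computable_tl)
  then show ?thesis by (rule computable_cong) simp
qed

lemma computable_rel_not:
  assumes "computable_rel n P"
  shows "computable_rel n (\<lambda>xs. \<not> P xs)"
proof -
  have "computable n (\<lambda>xs. if P xs then 0 else 1)"
    using assms by (intro computable_if computable_const)
  then show ?thesis unfolding computable_rel_def by (rule computable_cong) simp
qed

lemma computable_rel_conj:
  assumes "computable_rel n P" "computable_rel n Q"
  shows "computable_rel n (\<lambda>xs. P xs \<and> Q xs)"
proof -
  have "computable n (\<lambda>xs. if P xs then (if Q xs then 1 else 0) else 0)"
    using assms by (intro computable_if computable_const)
  then show ?thesis unfolding computable_rel_def by (rule computable_cong) simp
qed

lemma computable_rel_disj:
  "computable_rel n P \<Longrightarrow> computable_rel n Q \<Longrightarrow> computable_rel n (\<lambda>xs. P xs \<or> Q xs)"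
  using computable_rel_not[OF computable_rel_conj[OF computable_rel_not computable_rel_not], of n P Q]
  by simp

lemma computable_rel_imp:
  "computable_rel n P \<Longrightarrow> computable_rel n Q \<Longrightarrow> computable_rel n (\<lambda>xs. P xs \<longrightarrow> Q xs)"
  using computable_rel_disj[OF computable_rel_not, of n P Q] by simp

lemma computable_diff:
  assumes "computable n f" "computable n g"
  shows "computable n (\<lambda>xs. f xs - g xs)"
proof -
  have "computable (Suc 0) (\<lambda>xs. rec_nat 0 (\<lambda>k _. k) (hd xs))"
    by (intro computable_rec_nat computable_const computable_arg0)
  moreover have "rec_nat 0 (\<lambda>k _. k) m = m - 1" for m :: nat
    by (cases m) simp_all
  ultimately have "computable (Suc 0) (\<lambda>xs. hd xs - 1)" by simp
  then have pred: "computable m a \<Longrightarrow> computable m (\<lambda>xs. a xs - 1)" for m a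
    by (rule computable_compose1)
  have "computable n (\<lambda>xs. rec_nat (f xs) (\<lambda>_ r. r - 1) (g xs))"
    by (intro computable_rec_nat assms pred computable_arg1)
  moreover have "rec_nat a (\<lambda>_ r. r - 1) b = a - b" for a b :: nat
    by (induction b) simp_all
  ultimately show ?thesis by simp
qed

lemma computable_rel_le:
  assumes "computable n f" "computable n g"
  shows "computable_rel n (\<lambda>xs. f xs \<le> g xs)"
proof -
  have "computable n (\<lambda>xs. 1 - (f xs - g xs))"
    by (intro computable_diff computable_const assms)
  then show ?thesis unfolding computable_rel_def by (rule computable_cong) auto
qed

lemma computable_rel_less:
  "computable n f \<Longrightarrow> computable n g \<Longrightarrow> computable_rel n (\<lambda>xs. f xs < g xs)"
  using computable_rel_not[OF computable_rel_le, of n g f] by (simp add: not_le)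

lemma computable_rel_eq:
  fixes f g :: "nat list \<Rightarrow> nat"
  shows "computable n f \<Longrightarrow> computable n g \<Longrightarrow> computable_rel n (\<lambda>xs. f xs = g xs)"
  using computable_rel_conj[OF computable_rel_le computable_rel_le, of n f g g f]
  by (simp add: eq_iff)

lemma computable_add:
  assumes "computable n f" "computable n g"
  shows "computable n (\<lambda>xs. f xs + g xs)"
proof -
  have "computable n (\<lambda>xs. rec_nat (f xs) (\<lambda>_ r. Suc r) (g xs))"
    by (intro computable_rec_nat assms computable_Suc computable_arg1)
  moreover have "rec_nat a (\<lambda>_ r. Suc r) b = a + b" for a b :: nat
    by (induction b) simp_all
  ultimately show ?thesis by simp
qed

text \<open>
  The workhorse: products, bounded quantifiers, codes of bounded comprehensions and functions given
  by a bounded unique description are all sums.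
\<close>

lemma computable_sum:
  assumes t: "computable n t" and g: "computable (Suc n) (\<lambda>ys. g (hd ys) (tl ys))"
  shows "computable n (\<lambda>xs. \<Sum>k<t xs. g k xs)"
proof -
  \<comment> \<open>the recursion step has the accumulator as an additional second argument, which \<open>g\<close> skips\<close>
  let ?gs = "(\<lambda>ys. ys ! 0) # map (\<lambda>i ys. ys ! Suc (Suc i)) [0..<n]"
  have "computable (Suc (Suc n))
      (\<lambda>ys. (\<lambda>ys. g (hd ys) (tl ys)) (map (\<lambda>h. h ys) ?gs))"
    by (rule computable_comp) (use g in \<open>auto intro: computable_nth\<close>)
  then have "computable (Suc (Suc n)) (\<lambda>ys. g (hd ys) (tl (tl ys)))"
  proof (rule computable_cong)
    fix ys :: "nat list" assume "length ys = Suc (Suc n)"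
    then obtain a b zs where "ys = a # b # zs" "length zs = n" by (metis length_Suc_conv)
    moreover from this have "map (\<lambda>h. h ys) (map (\<lambda>i ys. ys ! Suc (Suc i)) [0..<n]) = zs"
      by (intro nth_equalityI) auto
    ultimately show "g (hd (map (\<lambda>h. h ys) ?gs)) (tl (map (\<lambda>h. h ys) ?gs)) = g (hd ys) (tl (tl ys))"
      by simp
  qed
  then have "computable n (\<lambda>xs. rec_nat 0 (\<lambda>k r. r + g k xs) (t xs))"
    by (intro computable_rec_nat computable_const computable_add computable_arg1 t)
  moreover have "rec_nat 0 (\<lambda>k r. r + h k) m = (\<Sum>k<m. h k)" for h :: "nat \<Rightarrow> nat" and m
    by (induction m) simp_all
  ultimately show ?thesis by simp
qed

lemma computable_mult:
  assumes "computable n f" "computable n g"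
  shows "computable n (\<lambda>xs. f xs * g xs)"
proof -
  have "computable n (\<lambda>xs. \<Sum>k<f xs. g xs)"
    by (intro computable_sum computable_tl assms)
  then show ?thesis by simp
qed

lemma computable_power2:
  assumes "computable n f"
  shows "computable n (\<lambda>xs. 2 ^ f xs)"
proof -
  have "computable n (\<lambda>xs. rec_nat 1 (\<lambda>_ r. r + r) (f xs))"
    by (intro computable_rec_nat computable_const computable_add computable_arg1 assms)
  moreover have "rec_nat 1 (\<lambda>_ r. r + r) m = (2 :: nat) ^ m" for m
    by (induction m) simp_all
  ultimately show ?thesis by simp
qed

lemma computable_rel_bex:
  assumes "computable n t" "computable_rel (Suc n) (\<lambda>ys. P (hd ys) (tl ys))"
  shows "computable_rel n (\<lambda>xs. \<exists>k<t xs. P k xs)"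
proof -
  have "computable_rel n (\<lambda>xs. 0 < (\<Sum>k<t xs. if P k xs then 1 else (0 :: nat)))"
    using assms unfolding computable_rel_def[of "Suc n"]
    by (intro computable_rel_less computable_const computable_sum)
  moreover have "0 < (\<Sum>k<m. if Q k then 1 else (0 :: nat)) \<longleftrightarrow> (\<exists>k<m. Q k)" for m :: nat and Q
    by (induction m) (auto simp: less_Suc_eq)
  ultimately show ?thesis by simp
qed

lemma computable_rel_ball:
  assumes "computable n t" "computable_rel (Suc n) (\<lambda>ys. P (hd ys) (tl ys))"
  shows "computable_rel n (\<lambda>xs. \<forall>k<t xs. P k xs)"
  using computable_rel_not[OF computable_rel_bex[OF assms(1) computable_rel_not[OF assms(2)]]]
  by simp

lemmas computable_basic_intros =
  computable_arg0 computable_arg1 computable_arg2 computable_arg3 computable_arg4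
  computable_Suc computable_const computable_if computable_diff computable_add computable_mult
  computable_power2 computable_sum
  computable_rel_not computable_rel_conj computable_rel_disj computable_rel_imp
  computable_rel_le computable_rel_less computable_rel_eq computable_rel_bex computable_rel_ball

lemma computable_rel_even: "computable n f \<Longrightarrow> computable_rel n (\<lambda>xs. even (f xs))"
proof (rule computable_rel_compose1[of even])
  have "computable_rel (Suc 0) (\<lambda>xs. \<exists>k<Suc (hd xs). hd xs = 2 * k)"
    by (intro computable_basic_intros)
  moreover have "(\<exists>k<Suc m. m = 2 * k) \<longleftrightarrow> even m" for m :: nat
    by presburger
  ultimately show "computable_rel (Suc 0) (\<lambda>xs. even (hd xs))" by simp
qed

lemma computable_prod_encode:
  assumes "computable n f" "computable n g"
  shows "computable n (\<lambda>xs. prod_encode (f xs, g xs))"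
proof -
  have "triangle m = (\<Sum>k<Suc m. k)" for m
    by (induction m) simp_all
  then show ?thesis
    unfolding prod_encode_def prod.case
    by (simp only:) (intro computable_basic_intros assms)
qed

text \<open>
  The digit of weight \<open>2 ^ k\<close> is found by a bounded search for quotient and remainder.
\<close>

lemma computable_rel_set_decode:
  assumes "computable n f" "computable n g"
  shows "computable_rel n (\<lambda>xs. f xs \<in> set_decode (g xs))"
  using _ assms
proof (rule computable_rel_compose2[of "\<lambda>k b. k \<in> set_decode b"])
  have "computable_rel (Suc (Suc 0)) (\<lambda>xs. \<exists>q<Suc (hd (tl xs)). \<exists>r<2 ^ hd xs.
      hd (tl xs) = (2 * q + 1) * 2 ^ hd xs + r)"
    by (intro computable_basic_intros)
  moreover have "(\<exists>q<Suc b. \<exists>r<2 ^ k. b = (2 * q + 1) * 2 ^ k + r) \<longleftrightarrow> k \<in> set_decode b"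
    for b k :: nat
  proof
    assume "k \<in> set_decode b"
    then obtain q where q: "b div 2 ^ k = 2 * q + 1"
      by (auto simp: set_decode_def elim: oddE)
    then have "b = (2 * q + 1) * 2 ^ k + b mod 2 ^ k" by (metis div_mult_mod_eq)
    moreover have "q < Suc b"
      using div_le_dividend[of b "2 ^ k"] q by linarith
    ultimately show "\<exists>q<Suc b. \<exists>r<2 ^ k. b = (2 * q + 1) * 2 ^ k + r"
      by (metis mod_less_divisor zero_less_numeral zero_less_power)
  next
    assume "\<exists>q<Suc b. \<exists>r<2 ^ k. b = (2 * q + 1) * 2 ^ k + r"
    then obtain q r where "r < 2 ^ k" "b = r + (2 * q + 1) * 2 ^ k" by auto
    then have "b div 2 ^ k = 2 * q + 1" by (metis add_0_right div_less div_mult_self1 power_not_zero zero_neq_numeral add.commute)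
    then show "k \<in> set_decode b" by (simp add: set_decode_def)
  qed
  ultimately show "computable_rel (Suc (Suc 0)) (\<lambda>xs. hd xs \<in> set_decode (hd (tl xs)))" by simp
qed

lemma computable_set_encode:
  assumes "computable n t" "computable_rel (Suc n) (\<lambda>ys. P (hd ys) (tl ys))"
  shows "computable n (\<lambda>xs. set_encode {k. k < t xs \<and> P k xs})"
proof -
  have "set_encode {k. k < m \<and> Q k} = (\<Sum>k<m. if Q k then 2 ^ k else 0)" for m Q
  proof -
    have "{k. k < m \<and> Q k} = {..<m} \<inter> {k. Q k}" by auto
    then show ?thesis by (simp add: set_encode_def sum.inter_restrict)
  qed
  then show ?thesis
    by (simp only:) (intro computable_basic_intros assms)
qed

lemmas computable_intros =
  computable_basic_intros computable_rel_even computable_prod_encode computable_rel_set_decode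
  computable_set_encode


section \<open>Refutability as an inductive predicate\<close>

text \<open>
  The calculus states the rules for a context without the principal formula. Here they are restated
  for a block that contains it, which is the form in which they are applied backwards.
\<close>

lemma BTi_rule_intros:
  "T (And A B) \<in> \<Pi> \<Longrightarrow> BTi_rule \<Pi> [insert (T A) (insert (T B) (\<Pi> - {T (And A B)}))]"
  "F (Or A B) \<in> \<Pi> \<Longrightarrow> BTi_rule \<Pi> [insert (F A) (insert (F B) (\<Pi> - {F (Or A B)}))]"
  "T (Or A B) \<in> \<Pi> \<Longrightarrow>
    BTi_rule \<Pi> [insert (T A) (\<Pi> - {T (Or A B)}), insert (T B) (\<Pi> - {T (Or A B)})]"
  "F (And A B) \<in> \<Pi> \<Longrightarrow>
    BTi_rule \<Pi> [insert (F A) (\<Pi> - {F (And A B)}), insert (F B) (\<Pi> - {F (And A B)})]"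
  "T (Imp A B) \<in> \<Pi> \<Longrightarrow> BTi_rule \<Pi> [insert (F A) \<Pi>, insert (T B) (\<Pi> - {T (Imp A B)})]"
  "F (Imp A B) \<in> \<Pi> \<Longrightarrow> BTi_rule \<Pi> [insert (T A) (insert (F B) (T_part \<Pi>))]"
proof -
  have absorb: "insert \<phi> (\<Pi> - {\<phi>}) = \<Pi>" if "\<phi> \<in> \<Pi>" for \<phi> using that by auto
  have T_part: "T_part (\<Pi> - {F (Imp A B)}) = T_part \<Pi>" by (auto simp: T_part_def)
  have reorder: "insert (T (Imp A B)) (insert (F A) (\<Pi> - {T (Imp A B)})) = insert (F A) \<Pi>"
    if "T (Imp A B) \<in> \<Pi>" using that by auto
  show "T (And A B) \<in> \<Pi> \<Longrightarrow> BTi_rule \<Pi> [insert (T A) (insert (T B) (\<Pi> - {T (And A B)}))]"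
    using BTi_rule.TAnd[of A B "\<Pi> - {T (And A B)}"] by (simp only: absorb) simp
  show "F (Or A B) \<in> \<Pi> \<Longrightarrow> BTi_rule \<Pi> [insert (F A) (insert (F B) (\<Pi> - {F (Or A B)}))]"
    using BTi_rule.FOr[of A B "\<Pi> - {F (Or A B)}"] by (simp only: absorb) simp
  show "T (Or A B) \<in> \<Pi> \<Longrightarrow>
      BTi_rule \<Pi> [insert (T A) (\<Pi> - {T (Or A B)}), insert (T B) (\<Pi> - {T (Or A B)})]"
    using BTi_rule.TOr[of A B "\<Pi> - {T (Or A B)}"] by (simp only: absorb) simp
  show "F (And A B) \<in> \<Pi> \<Longrightarrow>
      BTi_rule \<Pi> [insert (F A) (\<Pi> - {F (And A B)}), insert (F B) (\<Pi> - {F (And A B)})]"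
    using BTi_rule.FAnd[of A B "\<Pi> - {F (And A B)}"] by (simp only: absorb) simp
  show "T (Imp A B) \<in> \<Pi> \<Longrightarrow>
      BTi_rule \<Pi> [insert (F A) \<Pi>, insert (T B) (\<Pi> - {T (Imp A B)})]"
    using BTi_rule.TImp[of A B "\<Pi> - {T (Imp A B)}"] by (simp only: absorb reorder) simp
  show "F (Imp A B) \<in> \<Pi> \<Longrightarrow> BTi_rule \<Pi> [insert (T A) (insert (F B) (T_part \<Pi>))]"
    using BTi_rule.FImp[of A B "\<Pi> - {F (Imp A B)}"] by (simp only: absorb T_part) simp
qed

text \<open>
  The two components are parameters so that, on codes, a rule instance is found by a search for a
  pair of numbers.
\<close>

definition BTi_instance :: "form \<Rightarrow> form \<Rightarrow> block \<Rightarrow> block list \<Rightarrow> bool" where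
  "BTi_instance A B \<Pi> cs \<longleftrightarrow>
      T (And A B) \<in> \<Pi> \<and> cs = [insert (T A) (insert (T B) (\<Pi> - {T (And A B)}))]
    \<or> F (Or A B) \<in> \<Pi> \<and> cs = [insert (F A) (insert (F B) (\<Pi> - {F (Or A B)}))]
    \<or> T (Or A B) \<in> \<Pi> \<and> cs = [insert (T A) (\<Pi> - {T (Or A B)}), insert (T B) (\<Pi> - {T (Or A B)})]
    \<or> F (And A B) \<in> \<Pi> \<and> cs = [insert (F A) (\<Pi> - {F (And A B)}), insert (F B) (\<Pi> - {F (And A B)})]
    \<or> T (Imp A B) \<in> \<Pi> \<and> cs = [insert (F A) \<Pi>, insert (T B) (\<Pi> - {T (Imp A B)})]
    \<or> F (Imp A B) \<in> \<Pi> \<and> cs = [insert (T A) (insert (F B) (T_part \<Pi>))]"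

lemma BTi_rule_iff: "BTi_rule \<Pi> cs \<longleftrightarrow> (\<exists>A B. BTi_instance A B \<Pi> cs)"
proof
  assume "BTi_rule \<Pi> cs"
  then show "\<exists>A B. BTi_instance A B \<Pi> cs"
  proof cases
    case (TImp A B \<Pi>')
    then have "BTi_instance A B \<Pi> cs" by (simp add: BTi_instance_def insert_commute)
    then show ?thesis by blast
  next
    case (FImp A B \<Pi>')
    moreover have "T_part \<Pi> = T_part \<Pi>'" using FImp by (auto simp: T_part_def)
    ultimately have "BTi_instance A B \<Pi> cs" by (simp add: BTi_instance_def)
    then show ?thesis by blast
  next
    case (TAnd A B)
    then have "BTi_instance A B \<Pi> cs" by (simp add: BTi_instance_def)
    then show ?thesis by blast
  next
    case (FOr A B)
    then have "BTi_instance A B \<Pi> cs" by (simp add: BTi_instance_def)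
    then show ?thesis by blast
  next
    case (TOr A B)
    then have "BTi_instance A B \<Pi> cs" by (simp add: BTi_instance_def)
    then show ?thesis by blast
  next
    case (FAnd A B)
    then have "BTi_instance A B \<Pi> cs" by (simp add: BTi_instance_def)
    then show ?thesis by blast
  qed
next
  assume "\<exists>A B. BTi_instance A B \<Pi> cs"
  then show "BTi_rule \<Pi> cs"
    unfolding BTi_instance_def by (elim exE disjE conjE) (simp_all only: BTi_rule_intros)
qed

lemma refutable_closed: "closed_block \<Pi> \<Longrightarrow> refutable \<Pi>"
  unfolding refutable_def by (intro exI[of _ "Node \<Pi> []"]) (simp add: tableau.leaf)

lemma refutable_rule:
  assumes "BTi_rule \<Pi> cs" "\<forall>c \<in> set cs. refutable c"
  shows "refutable \<Pi>"
proof -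
  obtain t where t: "\<And>c. c \<in> set cs \<Longrightarrow>
      tableau (t c) \<and> root (t c) = c \<and> (\<forall>\<Sigma> \<in> leaves (t c). closed_block \<Sigma>)"
    using assms(2) unfolding refutable_def by metis
  have "map root (map t cs) = cs" using t by (simp add: map_idI)
  then have "tableau (Node \<Pi> (map t cs))"
    using assms(1) t by (intro tableau.expand) simp_all
  moreover have "cs \<noteq> []" using assms(1) by cases simp_all
  ultimately show ?thesis
    using t unfolding refutable_def by (intro exI[of _ "Node \<Pi> (map t cs)"]) auto
qed

lemma refutable_rule_induct [consumes 1, case_names closed rule]:
  assumes "refutable \<Pi>"
    and closed: "\<And>\<Pi>. closed_block \<Pi> \<Longrightarrow> P \<Pi>"
    and rule: "\<And>\<Pi> cs. BTi_rule \<Pi> cs \<Longrightarrow> \<forall>c \<in> set cs. refutable c \<and> P c \<Longrightarrow> P \<Pi>"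
  shows "P \<Pi>"
proof -
  have "tableau t \<Longrightarrow> \<forall>\<Sigma> \<in> leaves t. closed_block \<Sigma> \<Longrightarrow> refutable (root t) \<and> P (root t)" for t
  proof (induction rule: tableau.induct)
    case (leaf \<Pi>)
    then show ?case using closed refutable_closed by simp
  next
    case (expand \<Pi> ts)
    from expand.hyps(1) have "ts \<noteq> []" by cases auto
    with expand have "\<forall>c \<in> set (map root ts). refutable c \<and> P c" by auto
    then show ?case
      using rule[OF expand.hyps(1)] refutable_rule[OF expand.hyps(1)] by simp
  qed
  with assms(1) show ?thesis unfolding refutable_def by blast
qed

lemma refutable_rule1: "BTi_rule \<Pi> [c] \<Longrightarrow> refutable c \<Longrightarrow> refutable \<Pi>"
  by (erule refutable_rule) simp

lemma refutable_rule2: "BTi_rule \<Pi> [c, d] \<Longrightarrow> refutable c \<Longrightarrow> refutable d \<Longrightarrow> refutable \<Pi>"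
  by (erule refutable_rule) simp

lemmas refutable_rules =
  refutable_rule1[OF BTi_rule_intros(1)] refutable_rule1[OF BTi_rule_intros(2)]
  refutable_rule2[OF BTi_rule_intros(3)] refutable_rule2[OF BTi_rule_intros(4)]
  refutable_rule2[OF BTi_rule_intros(5)] refutable_rule1[OF BTi_rule_intros(6)]

lemma refutable_induct [consumes 1, case_names closed TAnd FOr TOr FAnd TImp FImp]:
  assumes "refutable \<Pi>"
    and "\<And>\<Pi>. closed_block \<Pi> \<Longrightarrow> P \<Pi>"
    and "\<And>A B \<Pi>. T (And A B) \<in> \<Pi> \<Longrightarrow> P (insert (T A) (insert (T B) (\<Pi> - {T (And A B)}))) \<Longrightarrow> P \<Pi>"
    and "\<And>A B \<Pi>. F (Or A B) \<in> \<Pi> \<Longrightarrow> P (insert (F A) (insert (F B) (\<Pi> - {F (Or A B)}))) \<Longrightarrow> P \<Pi>"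
    and "\<And>A B \<Pi>. T (Or A B) \<in> \<Pi> \<Longrightarrow> P (insert (T A) (\<Pi> - {T (Or A B)})) \<Longrightarrow>
      P (insert (T B) (\<Pi> - {T (Or A B)})) \<Longrightarrow> P \<Pi>"
    and "\<And>A B \<Pi>. F (And A B) \<in> \<Pi> \<Longrightarrow> P (insert (F A) (\<Pi> - {F (And A B)})) \<Longrightarrow>
      P (insert (F B) (\<Pi> - {F (And A B)})) \<Longrightarrow> P \<Pi>"
    and "\<And>A B \<Pi>. T (Imp A B) \<in> \<Pi> \<Longrightarrow> P (insert (F A) \<Pi>) \<Longrightarrow>
      P (insert (T B) (\<Pi> - {T (Imp A B)})) \<Longrightarrow> P \<Pi>"
    and "\<And>A B \<Pi>. F (Imp A B) \<in> \<Pi> \<Longrightarrow> P (insert (T A) (insert (F B) (T_part \<Pi>))) \<Longrightarrow> P \<Pi>"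
  shows "P \<Pi>"
  using assms(1)
proof (induction rule: refutable_rule_induct)
  case (closed \<Pi>)
  then show ?case by (rule assms(2))
next
  case (rule \<Pi> cs)
  then show ?case
    unfolding BTi_rule_iff BTi_instance_def
    by (elim exE disjE conjE; hypsubst)
      (erule assms(3) assms(4) assms(5) assms(6) assms(7) assms(8); simp only: list.set ball_simps simp_thms)+
qed

text \<open>
  A rule applied to \<open>\<Pi>\<close> applies to a larger block with the same principal formula,
  and each child grows along. The induction hypothesis has to hold for all supersets, since the
  surplus differs from child to child.
\<close>

lemma refutable_mono: "refutable \<Pi> \<Longrightarrow> \<Pi> \<subseteq> \<Pi>' \<Longrightarrow> refutable \<Pi>'"
proof (induction arbitrary: \<Pi>' rule: refutable_induct)
  case (closed \<Pi>)
  then have "closed_block \<Pi>'" unfolding closed_block_def by blast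
  then show ?case by (rule refutable_closed)
next
  case (TAnd A B \<Pi>)
  show ?case
    by (rule refutable_rules(1)[of A B \<Pi>'], use TAnd.hyps TAnd.prems in blast)
      (rule TAnd.IH, use TAnd.prems in auto)+
next
  case (FOr A B \<Pi>)
  show ?case
    by (rule refutable_rules(2)[of A B \<Pi>'], use FOr.hyps FOr.prems in blast)
      (rule FOr.IH, use FOr.prems in auto)+
next
  case (TOr A B \<Pi>)
  show ?case
    by (rule refutable_rules(3)[of A B \<Pi>'], use TOr.hyps TOr.prems in blast)
      (rule TOr.IH, use TOr.prems in auto)+
next
  case (FAnd A B \<Pi>)
  show ?case
    by (rule refutable_rules(4)[of A B \<Pi>'], use FAnd.hyps FAnd.prems in blast)
      (rule FAnd.IH, use FAnd.prems in auto)+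
next
  case (TImp A B \<Pi>)
  show ?case
    by (rule refutable_rules(5)[of A B \<Pi>'], use TImp.hyps TImp.prems in blast)
      (rule TImp.IH, use TImp.prems in auto)+
next
  case (FImp A B \<Pi>)
  show ?case
    by (rule refutable_rules(6)[of A B \<Pi>'], use FImp.hyps FImp.prems in blast)
      (rule FImp.IH, use FImp.prems in \<open>auto simp: T_part_def\<close>)+
qed


section \<open>The finite search space\<close>

lemma form_code_component:
  "form_code A < form_code (And A B)" "form_code B < form_code (And A B)"
  "form_code A < form_code (Or A B)" "form_code B < form_code (Or A B)"
  "form_code A < form_code (Imp A B)" "form_code B < form_code (Imp A B)"
  using le_prod_encode_1[of "form_code A" "form_code B"] le_prod_encode_2[of "form_code B" "form_code A"]
  by simp_all

text \<open>
  An initial segment of the codes, so that the blocks inside it are exactly those with code below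
  \<open>2 ^ (2 * n)\<close>. The even bound admits \<open>T A\<close> and \<open>F A\<close> together, which makes the set closed
  under components, whatever their sign: they have smaller formula codes.
\<close>

definition universe :: "nat \<Rightarrow> block" where
  "universe n = {\<phi>. sform_code \<phi> < 2 * n}"

lemma in_universe [simp]:
  "T A \<in> universe n \<longleftrightarrow> form_code A < n"
  "F A \<in> universe n \<longleftrightarrow> form_code A < n"
  by (auto simp: universe_def)

lemma finite_universe: "finite (universe n)"
proof -
  have "inj sform_code" by (simp add: inj_def)
  then have "finite (sform_code -` {..<2 * n})" by (rule finite_vimageI[rotated]) simp
  then show ?thesis by (simp add: universe_def vimage_def)
qed

lemma BTi_rule_universe:
  assumes "BTi_rule \<Pi> cs" "\<Pi> \<subseteq> universe n" "c \<in> set cs"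
  shows "c \<subseteq> universe n"
proof
  fix \<phi> assume "\<phi> \<in> c"
  note c = assms(3) this
  have lt: "\<phi> \<in> universe n"
    if "\<phi> = T C \<or> \<phi> = F C" "form_code C < form_code D" "T D \<in> \<Pi> \<or> F D \<in> \<Pi>" for C D
  proof -
    have "form_code D < n" using that(3) subsetD[OF assms(2)] in_universe by blast
    with that show ?thesis by auto
  qed
  have old: "\<phi> \<in> universe n" if "\<phi> \<in> \<Pi>" using that assms(2) by blast
  show "\<phi> \<in> universe n"
    using assms(1)
  proof cases
    case (TAnd A B \<Pi>')
    with c have "\<phi> = T A \<or> \<phi> = T B \<or> \<phi> \<in> \<Pi>" by auto
    then show ?thesis using TAnd(1) old lt[of _ "And A B"] form_code_component(1,2) by blast
  next
    case (FOr A B \<Pi>')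
    with c have "\<phi> = F A \<or> \<phi> = F B \<or> \<phi> \<in> \<Pi>" by auto
    then show ?thesis using FOr(1) old lt[of _ "Or A B"] form_code_component(3,4) by blast
  next
    case (TOr A B \<Pi>')
    with c have "\<phi> = T A \<or> \<phi> = T B \<or> \<phi> \<in> \<Pi>" by auto
    then show ?thesis using TOr(1) old lt[of _ "Or A B"] form_code_component(3,4) by blast
  next
    case (FAnd A B \<Pi>')
    with c have "\<phi> = F A \<or> \<phi> = F B \<or> \<phi> \<in> \<Pi>" by auto
    then show ?thesis using FAnd(1) old lt[of _ "And A B"] form_code_component(1,2) by blast
  next
    case (TImp A B \<Pi>')
    with c have "\<phi> = F A \<or> \<phi> = T B \<or> \<phi> \<in> \<Pi>" by auto
    then show ?thesis using TImp(1) old lt[of _ "Imp A B"] form_code_component(5,6) by blast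
  next
    case (FImp A B \<Pi>')
    with c have "\<phi> = T A \<or> \<phi> = F B \<or> \<phi> \<in> \<Pi>" by (auto simp: T_part_def)
    then show ?thesis using FImp(1) old lt[of _ "Imp A B"] form_code_component(5,6) by blast
  qed
qed


section \<open>Kripke semantics\<close>

primrec forces :: "('w \<Rightarrow> 'w \<Rightarrow> bool) \<Rightarrow> ('w \<Rightarrow> nat \<Rightarrow> bool) \<Rightarrow> 'w \<Rightarrow> form \<Rightarrow> bool" where
  "forces R V w (Var p) \<longleftrightarrow> V w p"
| "forces R V w Bot \<longleftrightarrow> False"
| "forces R V w (And A B) \<longleftrightarrow> forces R V w A \<and> forces R V w B"
| "forces R V w (Or A B) \<longleftrightarrow> forces R V w A \<or> forces R V w B"
| "forces R V w (Imp A B) \<longleftrightarrow> (\<forall>v. R w v \<longrightarrow> forces R V v A \<longrightarrow> forces R V v B)"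

definition kripke_model :: "('w \<Rightarrow> 'w \<Rightarrow> bool) \<Rightarrow> ('w \<Rightarrow> nat \<Rightarrow> bool) \<Rightarrow> bool" where
  "kripke_model R V \<longleftrightarrow> reflp R \<and> transp R \<and> (\<forall>w v p. R w v \<longrightarrow> V w p \<longrightarrow> V v p)"

lemma forces_mono:
  assumes "kripke_model R V"
  shows "R w v \<Longrightarrow> forces R V w A \<Longrightarrow> forces R V v A"
proof (induction A arbitrary: w v)
  case (Var p)
  then show ?case using assms unfolding kripke_model_def by auto
next
  case (Imp A B)
  then show ?case using assms unfolding kripke_model_def by (auto dest: transpD)
qed auto

lemma NJ_sound:
  assumes "kripke_model R V"
  shows "NJ \<Gamma> A \<Longrightarrow> \<forall>B \<in> \<Gamma>. forces R V w B \<Longrightarrow> forces R V w A"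
proof (induction arbitrary: w rule: NJ.induct)
  case (OrE \<Gamma> A B C)
  then have "forces R V w A \<or> forces R V w B" by auto
  with OrE show ?case by auto
next
  case (ImpI A \<Gamma> B)
  have "forces R V v B" if "R w v" "forces R V v A" for v
    using ImpI that forces_mono[OF assms that(1)] by auto
  then show ?case by simp
next
  case (ImpE \<Gamma> A B)
  moreover have "R w w" using assms unfolding kripke_model_def by (simp add: reflpD)
  ultimately show ?case by auto
qed auto

lemma G3Ti_sound:
  assumes "kripke_model R V"
  shows "G3Ti \<Gamma> \<Delta> \<Longrightarrow> \<forall>A \<in># \<Gamma>. forces R V w A \<Longrightarrow> \<exists>B \<in># \<Delta>. forces R V w B"
proof (induction arbitrary: w rule: G3Ti.induct)
  case (ImpL A B \<Gamma> \<Delta>)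
  have "R w w" using assms unfolding kripke_model_def by (simp add: reflpD)
  show ?case
  proof (cases "forces R V w A")
    case True
    with ImpL.prems \<open>R w w\<close> have "forces R V w B" by simp
    with ImpL show ?thesis by auto
  next
    case False
    with ImpL show ?thesis by auto
  qed
next
  case (OrL A \<Gamma> \<Delta> B)
  then have "forces R V w A \<or> forces R V w B" by simp
  with OrL show ?case by auto
next
  case (AndR \<Gamma> A \<Delta> B)
  then show ?case using AndR.IH(1)[of w] AndR.IH(2)[of w] by auto
next
  case (OrR \<Gamma> A B \<Delta>)
  then show ?case using OrR.IH[of w] by auto
next
  case (ImpR A \<Gamma> B \<Delta>)
  have "forces R V v B" if "R w v" "forces R V v A" for v
    using ImpR.IH[of v] ImpR.prems that forces_mono[OF assms that(1)] by auto
  then show ?case by simp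
qed auto


section \<open>Completeness of the block tableaux\<close>

text \<open>
  The downward saturation condition of a Hintikka set. The equation for \<open>T (Imp A B)\<close>
  covers the second child only: in the first child the formula stays and must be used again in later
  worlds.
\<close>

fun satisfied :: "block \<Rightarrow> sform \<Rightarrow> bool" where
  "satisfied H (T (And A B)) \<longleftrightarrow> T A \<in> H \<and> T B \<in> H"
| "satisfied H (F (Or A B)) \<longleftrightarrow> F A \<in> H \<and> F B \<in> H"
| "satisfied H (T (Or A B)) \<longleftrightarrow> T A \<in> H \<or> T B \<in> H"
| "satisfied H (F (And A B)) \<longleftrightarrow> F A \<in> H \<or> F B \<in> H"
| "satisfied H (T (Imp A B)) \<longleftrightarrow> T B \<in> H"
| "satisfied H _ \<longleftrightarrow> False"

lemma satisfied_mono: "satisfied H \<phi> \<Longrightarrow> H \<subseteq> H' \<Longrightarrow> satisfied H' \<phi>"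
  by (induction H \<phi> rule: satisfied.induct) auto

text \<open>
  A static branch is recorded by its current block \<open>\<Sigma>\<close> and by the set
  \<open>H\<close> of all signed formulae met on it. A formula that has been removed from the
  current block must have been satisfied.
\<close>

definition stage :: "nat \<Rightarrow> block \<times> block \<Rightarrow> bool" where
  "stage n = (\<lambda>(\<Sigma>, H). \<not> refutable \<Sigma> \<and> \<Sigma> \<subseteq> H \<and> H \<subseteq> universe n \<and> (\<forall>\<phi> \<in> H - \<Sigma>. satisfied H \<phi>))"

text \<open>
  A fully expanded branch: the history cannot grow and, for this history, the current block cannot
  shrink. The second condition lets a rule whose conclusions are already in the history be applied
  by just dropping the principal formula, which replaces a termination argument for branches.
\<close>

definition world :: "nat \<Rightarrow> block \<times> block \<Rightarrow> bool" where
  "world n = (\<lambda>(\<Sigma>, H). stage n (\<Sigma>, H)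
    \<and> (\<forall>\<Sigma>' H'. stage n (\<Sigma>', H') \<longrightarrow> H \<subseteq> H' \<longrightarrow> H' = H)
    \<and> (\<forall>\<Sigma>'. stage n (\<Sigma>', H) \<longrightarrow> \<Sigma>' \<subseteq> \<Sigma> \<longrightarrow> \<Sigma>' = \<Sigma>))"

lemma stage_extends_to_world:
  assumes "stage n (\<Sigma>, H)"
  obtains \<Sigma>' H' where "world n (\<Sigma>', H')" "H \<subseteq> H'"
proof -
  let ?\<H> = "{H'. \<exists>\<Sigma>'. stage n (\<Sigma>', H')}"
  have "?\<H> \<subseteq> Pow (universe n)" by (auto simp: stage_def)
  then have "finite ?\<H>" by (rule finite_subset) (simp add: finite_universe)
  moreover have "H \<in> ?\<H>" using assms by blast
  ultimately obtain H' where H': "H' \<in> ?\<H>" "H \<subseteq> H'" "\<forall>K \<in> ?\<H>. H' \<subseteq> K \<longrightarrow> H' = K"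
    using finite_has_maximal2[of ?\<H> H] by blast
  let ?\<S> = "{\<Sigma>'. stage n (\<Sigma>', H')}"
  have "?\<S> \<subseteq> Pow (universe n)" by (auto simp: stage_def)
  then have "finite ?\<S>" by (rule finite_subset) (simp add: finite_universe)
  moreover obtain \<Sigma>0 where "\<Sigma>0 \<in> ?\<S>" using H'(1) by blast
  ultimately obtain \<Sigma>' where "\<Sigma>' \<in> ?\<S>" "\<forall>K \<in> ?\<S>. K \<subseteq> \<Sigma>' \<longrightarrow> \<Sigma>' = K"
    using finite_has_minimal2[of ?\<S> \<Sigma>0] by blast
  with H' have "world n (\<Sigma>', H')" unfolding world_def by blast
  then show thesis using H'(2) by (rule that)
qed

lemma world_unrefutable: "world n w \<Longrightarrow> \<not> refutable (fst w)"
  unfolding world_def stage_def by auto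

text \<open>
  If the history already satisfies \<open>\<phi>\<close>, then dropping \<open>\<phi>\<close> gives
  a smaller stage, as a subset of an unrefutable block is unrefutable.
\<close>

lemma world_unsatisfied:
  assumes "world n (\<Sigma>, H)" "\<phi> \<in> \<Sigma>"
  shows "\<not> satisfied H \<phi>"
proof
  assume "satisfied H \<phi>"
  with assms have "stage n (\<Sigma> - {\<phi>}, H)"
    unfolding world_def stage_def using refutable_mono[of "\<Sigma> - {\<phi>}" \<Sigma>] by auto
  with assms show False unfolding world_def by blast
qed

text \<open>
  Otherwise the child with new formulae \<open>N\<close> would be a stage; by maximality its history
  is still \<open>H\<close>, so \<open>H\<close> already satisfies \<open>\<phi>\<close>, which the
  previous lemma excludes.
\<close>

lemma world_no_progress:
  assumes w: "world n (\<Sigma>, H)" and "\<phi> \<in> \<Sigma>" and N: "N \<subseteq> universe n" "satisfied (H \<union> N) \<phi>"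
  shows "refutable (N \<union> (\<Sigma> - {\<phi>}))"
proof (rule ccontr)
  assume "\<not> refutable (N \<union> (\<Sigma> - {\<phi>}))"
  moreover have "satisfied (H \<union> N) \<psi>" if "\<psi> \<in> (H \<union> N) - (N \<union> (\<Sigma> - {\<phi>}))" for \<psi>
  proof (cases "\<psi> = \<phi>")
    case False
    with that have "\<psi> \<in> H - \<Sigma>" by blast
    with w have "satisfied H \<psi>" unfolding world_def stage_def by blast
    then show ?thesis by (rule satisfied_mono) blast
  qed (use N in simp)
  ultimately have "stage n (N \<union> (\<Sigma> - {\<phi>}), H \<union> N)"
    using w N(1) unfolding world_def stage_def by auto
  with w have "H \<union> N = H" unfolding world_def by blast
  with N(2) world_unsatisfied[OF w \<open>\<phi> \<in> \<Sigma>\<close>] show False by simp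
qed

lemma world_component:
  assumes "world n (\<Sigma>, H)" "\<phi> \<in> H" "\<phi> = T A \<or> \<phi> = F A" "form_code B < form_code A"
  shows "T B \<in> universe n" "F B \<in> universe n"
proof -
  have "\<phi> \<in> universe n" using assms(1,2) unfolding world_def stage_def by blast
  with assms(3,4) show "T B \<in> universe n" "F B \<in> universe n" by auto
qed

text \<open>
  By the previous lemma every child that satisfies its principal formula is refutable. If all
  children are of this kind, then \<open>\<Sigma>\<close> is refutable as well, so no such formula
  is left in \<open>\<Sigma>\<close>. The one exception is the first child for \<open>T (Imp A
  B)\<close>: it is unrefutable as the second child is refutable, hence \<open>F A\<close> does not
  enlarge the history.
\<close>

lemma world_hintikka:
  assumes w: "world n (\<Sigma>, H)" and \<phi>: "\<phi> \<in> H"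
  shows "satisfied H \<phi> \<or> (\<exists>A B. \<phi> = T (Imp A B) \<and> \<phi> \<in> \<Sigma> \<and> F A \<in> H)
    \<or> \<phi> \<in> \<Sigma> \<and> ((\<exists>p. \<phi> = T (Var p) \<or> \<phi> = F (Var p)) \<or> \<phi> = F Bot \<or> (\<exists>A B. \<phi> = F (Imp A B)))"
proof (cases "\<phi> \<in> \<Sigma>")
  case False
  with w \<phi> show ?thesis unfolding world_def stage_def by blast
next
  case True
  note comp = world_component[OF w \<phi>] and np = world_no_progress[OF w True]
  have unref: "\<not> refutable \<Sigma>" and "\<Sigma> \<subseteq> H" using w unfolding world_def stage_def by blast+
  consider (TAnd) A B where "\<phi> = T (And A B)" | (FOr) A B where "\<phi> = F (Or A B)"
    | (TOr) A B where "\<phi> = T (Or A B)" | (FAnd) A B where "\<phi> = F (And A B)"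
    | (TImp) A B where "\<phi> = T (Imp A B)" | (TBot) "\<phi> = T Bot"
    | (other) "(\<exists>p. \<phi> = T (Var p) \<or> \<phi> = F (Var p)) \<or> \<phi> = F Bot \<or> (\<exists>A B. \<phi> = F (Imp A B))"
    by (metis form.exhaust sform.exhaust)
  then show ?thesis
  proof cases
    case (TAnd A B)
    have "refutable ({T A, T B} \<union> (\<Sigma> - {\<phi>}))"
      by (rule np) (use TAnd comp form_code_component in auto)
    with unref refutable_rules(1)[of A B \<Sigma>] True TAnd show ?thesis by simp
  next
    case (FOr A B)
    have "refutable ({F A, F B} \<union> (\<Sigma> - {\<phi>}))"
      by (rule np) (use FOr comp form_code_component in auto)
    with unref refutable_rules(2)[of A B \<Sigma>] True FOr show ?thesis by simp
  next
    case (TOr A B)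
    have "refutable ({T A} \<union> (\<Sigma> - {\<phi>}))" "refutable ({T B} \<union> (\<Sigma> - {\<phi>}))"
      by (rule np; use TOr comp form_code_component in auto)+
    with unref refutable_rules(3)[of A B \<Sigma>] True TOr show ?thesis by simp
  next
    case (FAnd A B)
    have "refutable ({F A} \<union> (\<Sigma> - {\<phi>}))" "refutable ({F B} \<union> (\<Sigma> - {\<phi>}))"
      by (rule np; use FAnd comp form_code_component in auto)+
    with unref refutable_rules(4)[of A B \<Sigma>] True FAnd show ?thesis by simp
  next
    case (TImp A B)
    have "refutable ({T B} \<union> (\<Sigma> - {\<phi>}))"
      by (rule np) (use TImp comp form_code_component in auto)
    with unref refutable_rules(5)[of A B \<Sigma>] True TImp have *: "\<not> refutable (insert (F A) \<Sigma>)" by auto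
    have "F A \<in> universe n"
      using comp(2)[of "Imp A B" A] TImp form_code_component(5) by blast
    with w * have "stage n (insert (F A) \<Sigma>, insert (F A) H)"
      unfolding world_def stage_def by (auto intro: satisfied_mono)
    with w have "insert (F A) H = H" unfolding world_def by blast
    with True TImp show ?thesis by blast
  next
    case TBot
    with True have "closed_block \<Sigma>" unfolding closed_block_def by blast
    with unref refutable_closed show ?thesis by blast
  qed (use True in blast)
qed

text \<open>
  The block that the rule for \<open>F (Imp A B)\<close> produces keeps the \<open>T\<close>-part of
  the current block, but nothing of the rest of the history. This suffices for persistence: an atom
  is never removed, and a \<open>T\<close>-implication is removed only when its succedent has been
  asserted.
\<close>

definition jump :: "nat \<Rightarrow> block \<times> block \<Rightarrow> block \<times> block \<Rightarrow> bool" where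
  "jump n w v \<longleftrightarrow> world n w \<and> world n v \<and> T_part (fst w) \<subseteq> snd v"

lemma canonical_model: "kripke_model (jump n)\<^sup>*\<^sup>* (\<lambda>w p. T (Var p) \<in> fst w)"
proof -
  have step: "T (Var p) \<in> fst v" if "jump n w v" "T (Var p) \<in> fst w" for w v p
  proof -
    have "T (Var p) \<in> snd v" using that unfolding jump_def T_part_def by blast
    with that(1) world_hintikka[of n "fst v" "snd v" "T (Var p)"] show ?thesis
      unfolding jump_def by auto
  qed
  have "T (Var p) \<in> fst v" if "(jump n)\<^sup>*\<^sup>* w v" "T (Var p) \<in> fst w" for w v p
    using that by (induction rule: rtranclp_induct) (auto intro: step)
  then show ?thesis
    unfolding kripke_model_def by (auto intro: reflpI transpI)
qed

text \<open>
  The case that needs care is \<open>T (Imp A B)\<close>. Along a chain of jumps it either stays in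
  the current block, which puts \<open>F A\<close> into the history, or it is discarded in favour of
  \<open>T B\<close>; then \<open>B\<close> is forced there, and persistence of forcing carries
  \<open>B\<close> to all later worlds.
\<close>

lemma truth_lemma:
  assumes "world n w"
  shows "(T A \<in> snd w \<longrightarrow> forces (jump n)\<^sup>*\<^sup>* (\<lambda>w p. T (Var p) \<in> fst w) w A)
    \<and> (F A \<in> snd w \<longrightarrow> \<not> forces (jump n)\<^sup>*\<^sup>* (\<lambda>w p. T (Var p) \<in> fst w) w A)"
  using assms
proof (induction A arbitrary: w)
  case (Var p)
  note hint = world_hintikka[of n "fst w" "snd w", unfolded prod.collapse, OF Var]
  have "\<not> (T (Var p) \<in> fst w \<and> F (Var p) \<in> fst w)"
    using world_unrefutable[OF Var] refutable_closed unfolding closed_block_def by blast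
  then show ?case using hint[of "T (Var p)"] hint[of "F (Var p)"] by auto
next
  case Bot
  then show ?case using world_hintikka[of n "fst w" "snd w" "T Bot"] by auto
next
  case (And A B)
  show ?case
    using And.prems And.IH(1)[of w] And.IH(2)[of w]
      world_hintikka[of n "fst w" "snd w" "T (And A B)"]
      world_hintikka[of n "fst w" "snd w" "F (And A B)"] by auto
next
  case (Or A B)
  show ?case
    using Or.prems Or.IH(1)[of w] Or.IH(2)[of w]
      world_hintikka[of n "fst w" "snd w" "T (Or A B)"]
      world_hintikka[of n "fst w" "snd w" "F (Or A B)"] by auto
next
  case (Imp A B)
  let ?R = "(jump n)\<^sup>*\<^sup>*" and ?V = "\<lambda>w p. T (Var p) \<in> fst w"
  have local: "forces ?R ?V v B \<or> T (Imp A B) \<in> fst v \<and> F A \<in> snd v"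
    if "world n v" "T (Imp A B) \<in> snd v" for v
    using that Imp.IH(2)[of v] world_hintikka[of n "fst v" "snd v" "T (Imp A B)"] by auto
  have "forces ?R ?V v B" if T: "T (Imp A B) \<in> snd w" and v: "?R w v" "forces ?R ?V v A" for v
  proof -
    from v(1) have "world n v \<and> (forces ?R ?V v B \<or> T (Imp A B) \<in> fst v \<and> F A \<in> snd v)"
    proof (induction rule: rtranclp_induct)
      case base
      show ?case using local[OF Imp.prems T] Imp.prems by blast
    next
      case (step u v)
      have "forces ?R ?V v B" if "forces ?R ?V u B"
        using forces_mono[OF canonical_model _ that] step.hyps(2) by blast
      moreover have "T (Imp A B) \<in> snd v" if "T (Imp A B) \<in> fst u"
        using that step.hyps(2) unfolding jump_def T_part_def by blast
      ultimately show ?case using step local unfolding jump_def by blast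
    qed
    with v(2) Imp.IH(1) show ?thesis by blast
  qed
  moreover have "\<exists>v. ?R w v \<and> forces ?R ?V v A \<and> \<not> forces ?R ?V v B" if F: "F (Imp A B) \<in> snd w"
  proof -
    have "F (Imp A B) \<in> fst w"
      using world_hintikka[of n "fst w" "snd w"] Imp.prems F by fastforce
    moreover have unref: "\<not> refutable (fst w)" and sub: "fst w \<subseteq> universe n"
      using Imp.prems unfolding world_def stage_def by auto
    let ?\<Pi> = "insert (T A) (insert (F B) (T_part (fst w)))"
    have "\<not> refutable ?\<Pi>" using unref calculation refutable_rules(6) by blast
    moreover have "?\<Pi> \<subseteq> universe n"
      using BTi_rule_universe[OF BTi_rule_intros(6) sub] calculation(1) by simp
    ultimately have "stage n (?\<Pi>, ?\<Pi>)" unfolding stage_def by auto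
    then obtain \<Sigma> H where v: "world n (\<Sigma>, H)" "?\<Pi> \<subseteq> H" by (rule stage_extends_to_world)
    then have "jump n w (\<Sigma>, H)" using Imp.prems unfolding jump_def by auto
    with v Imp.IH[of "(\<Sigma>, H)"] show ?thesis by auto
  qed
  ultimately show ?case by auto
qed

lemma finite_block_in_universe:
  assumes "finite \<Pi>"
  obtains n where "\<Pi> \<subseteq> universe n"
proof -
  have "\<exists>n. \<forall>k \<in> sform_code ` \<Pi>. k < n"
    using assms by (meson finite_imageI finite_nat_set_iff_bounded)
  then obtain n where "\<forall>\<phi> \<in> \<Pi>. sform_code \<phi> < n" by auto
  then have "\<Pi> \<subseteq> universe n" unfolding universe_def by fastforce
  then show thesis by (rule that)
qed

text \<open>
  A finite unrefutable block is its own initial history, and it holds in any world that extends it.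
\<close>

theorem BTi_complete:
  assumes "finite \<Pi>" "\<not> refutable \<Pi>"
  shows "\<exists>R V (w :: block \<times> block). kripke_model R V \<and>
    (\<forall>A. T A \<in> \<Pi> \<longrightarrow> forces R V w A) \<and> (\<forall>A. F A \<in> \<Pi> \<longrightarrow> \<not> forces R V w A)"
proof -
  obtain n where "\<Pi> \<subseteq> universe n" using assms(1) by (rule finite_block_in_universe)
  with assms(2) have "stage n (\<Pi>, \<Pi>)" unfolding stage_def by auto
  then obtain \<Sigma> H where w: "world n (\<Sigma>, H)" "\<Pi> \<subseteq> H" by (rule stage_extends_to_world)
  have "(\<forall>A. T A \<in> \<Pi> \<longrightarrow> forces (jump n)\<^sup>*\<^sup>* (\<lambda>w p. T (Var p) \<in> fst w) (\<Sigma>, H) A) \<and>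
    (\<forall>A. F A \<in> \<Pi> \<longrightarrow> \<not> forces (jump n)\<^sup>*\<^sup>* (\<lambda>w p. T (Var p) \<in> fst w) (\<Sigma>, H) A)"
    using truth_lemma[OF w(1)] w(2) by auto
  with canonical_model show ?thesis by blast
qed


section \<open>Refutations as derivations\<close>

definition sequent_block :: "form multiset \<Rightarrow> form multiset \<Rightarrow> block" where
  "sequent_block \<Gamma> \<Delta> = T ` set_mset \<Gamma> \<union> F ` set_mset \<Delta>"

lemma in_sequent_block [simp]:
  "T A \<in> sequent_block \<Gamma> \<Delta> \<longleftrightarrow> A \<in># \<Gamma>" "F A \<in> sequent_block \<Gamma> \<Delta> \<longleftrightarrow> A \<in># \<Delta>"
  by (auto simp: sequent_block_def)

lemma subset_sequent_block:
  "\<Pi> \<subseteq> sequent_block \<Gamma> \<Delta> \<longleftrightarrow> (\<forall>A. T A \<in> \<Pi> \<longrightarrow> A \<in># \<Gamma>) \<and> (\<forall>A. F A \<in> \<Pi> \<longrightarrow> A \<in># \<Delta>)"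
proof
  assume "(\<forall>A. T A \<in> \<Pi> \<longrightarrow> A \<in># \<Gamma>) \<and> (\<forall>A. F A \<in> \<Pi> \<longrightarrow> A \<in># \<Delta>)"
  then have "\<phi> \<in> \<Pi> \<Longrightarrow> \<phi> \<in> sequent_block \<Gamma> \<Delta>" for \<phi> by (cases \<phi>) auto
  then show "\<Pi> \<subseteq> sequent_block \<Gamma> \<Delta>" by blast
qed (auto dest: subsetD)

text \<open>
  The inclusion takes the place of contraction and weakening: a multiset may contain further copies
  of a principal formula that the block loses, and the premisses of the sequent rule still include
  the child block.
\<close>

lemma refutable_imp_G3Ti: "refutable \<Pi> \<Longrightarrow> \<Pi> \<subseteq> sequent_block \<Gamma> \<Delta> \<Longrightarrow> G3Ti \<Gamma> \<Delta>"
proof (induction arbitrary: \<Gamma> \<Delta> rule: refutable_induct)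
  case (closed \<Pi>)
  then consider p where "Var p \<in># \<Gamma>" "Var p \<in># \<Delta>" | "Bot \<in># \<Gamma>"
    unfolding closed_block_def subset_sequent_block by blast
  then show ?case
  proof cases
    case 1
    then obtain \<Gamma>' \<Delta>' where "\<Gamma> = add_mset (Var p) \<Gamma>'" "\<Delta> = add_mset (Var p) \<Delta>'"
      by (meson multi_member_split)
    then show ?thesis by (simp add: G3Ti.Ax)
  next
    case 2
    then obtain \<Gamma>' where "\<Gamma> = add_mset Bot \<Gamma>'" by (meson multi_member_split)
    then show ?thesis by (simp add: G3Ti.BotL)
  qed
next
  case (TAnd A B \<Pi>)
  then obtain \<Gamma>' where \<Gamma>: "\<Gamma> = add_mset (And A B) \<Gamma>'"
    unfolding subset_sequent_block by (meson multi_member_split)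
  have "G3Ti (add_mset A (add_mset B \<Gamma>')) \<Delta>"
    by (rule TAnd.IH) (use TAnd.prems \<Gamma> in \<open>auto simp: subset_sequent_block\<close>)
  then show ?case unfolding \<Gamma> by (rule G3Ti.AndL)
next
  case (FOr A B \<Pi>)
  then obtain \<Delta>' where \<Delta>: "\<Delta> = add_mset (Or A B) \<Delta>'"
    unfolding subset_sequent_block by (meson multi_member_split)
  have "G3Ti \<Gamma> (add_mset A (add_mset B \<Delta>'))"
    by (rule FOr.IH) (use FOr.prems \<Delta> in \<open>auto simp: subset_sequent_block\<close>)
  then show ?case unfolding \<Delta> by (rule G3Ti.OrR)
next
  case (TOr A B \<Pi>)
  then obtain \<Gamma>' where \<Gamma>: "\<Gamma> = add_mset (Or A B) \<Gamma>'"
    unfolding subset_sequent_block by (meson multi_member_split)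
  have "G3Ti (add_mset A \<Gamma>') \<Delta>"
    by (rule TOr.IH(1)) (use TOr.prems \<Gamma> in \<open>auto simp: subset_sequent_block\<close>)
  moreover have "G3Ti (add_mset B \<Gamma>') \<Delta>"
    by (rule TOr.IH(2)) (use TOr.prems \<Gamma> in \<open>auto simp: subset_sequent_block\<close>)
  ultimately show ?case unfolding \<Gamma> by (rule G3Ti.OrL)
next
  case (FAnd A B \<Pi>)
  then obtain \<Delta>' where \<Delta>: "\<Delta> = add_mset (And A B) \<Delta>'"
    unfolding subset_sequent_block by (meson multi_member_split)
  have "G3Ti \<Gamma> (add_mset A \<Delta>')"
    by (rule FAnd.IH(1)) (use FAnd.prems \<Delta> in \<open>auto simp: subset_sequent_block\<close>)
  moreover have "G3Ti \<Gamma> (add_mset B \<Delta>')"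
    by (rule FAnd.IH(2)) (use FAnd.prems \<Delta> in \<open>auto simp: subset_sequent_block\<close>)
  ultimately show ?case unfolding \<Delta> by (rule G3Ti.AndR)
next
  case (TImp A B \<Pi>)
  then obtain \<Gamma>' where \<Gamma>: "\<Gamma> = add_mset (Imp A B) \<Gamma>'"
    unfolding subset_sequent_block by (meson multi_member_split)
  have "G3Ti (add_mset (Imp A B) \<Gamma>') (add_mset A \<Delta>)"
    by (rule TImp.IH(1)) (use TImp.prems \<Gamma> in \<open>auto simp: subset_sequent_block\<close>)
  moreover have "G3Ti (add_mset B \<Gamma>') \<Delta>"
    by (rule TImp.IH(2)) (use TImp.prems \<Gamma> in \<open>auto simp: subset_sequent_block\<close>)
  ultimately show ?case unfolding \<Gamma> by (rule G3Ti.ImpL)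
next
  case (FImp A B \<Pi>)
  then obtain \<Delta>' where \<Delta>: "\<Delta> = add_mset (Imp A B) \<Delta>'"
    unfolding subset_sequent_block by (meson multi_member_split)
  have "G3Ti (add_mset A \<Gamma>) {#B#}"
    by (rule FImp.IH) (use FImp.prems in \<open>auto simp: subset_sequent_block T_part_def\<close>)
  then show ?case unfolding \<Delta> by (rule G3Ti.ImpR)
qed

theorem G3Ti_iff_refutable: "G3Ti \<Gamma> \<Delta> \<longleftrightarrow> refutable (sequent_block \<Gamma> \<Delta>)"
proof
  assume G: "G3Ti \<Gamma> \<Delta>"
  show "refutable (sequent_block \<Gamma> \<Delta>)"
  proof (rule ccontr)
    assume "\<not> refutable (sequent_block \<Gamma> \<Delta>)"
    moreover have "finite (sequent_block \<Gamma> \<Delta>)" by (simp add: sequent_block_def)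
    ultimately obtain R V and w :: "block \<times> block" where
      w: "kripke_model R V" "\<And>A. A \<in># \<Gamma> \<Longrightarrow> forces R V w A" "\<And>A. A \<in># \<Delta> \<Longrightarrow> \<not> forces R V w A"
      using BTi_complete[of "sequent_block \<Gamma> \<Delta>"] unfolding in_sequent_block by blast
    then have "\<exists>B \<in># \<Delta>. forces R V w B" by (intro G3Ti_sound[OF w(1) G]) simp
    with w(3) show False by blast
  qed
next
  assume "refutable (sequent_block \<Gamma> \<Delta>)"
  then show "G3Ti \<Gamma> \<Delta>" by (rule refutable_imp_G3Ti) simp
qed

lemma NJ_weakening: "NJ \<Gamma> A \<Longrightarrow> \<Gamma> \<subseteq> \<Gamma>' \<Longrightarrow> NJ \<Gamma>' A"
proof (induction arbitrary: \<Gamma>' rule: NJ.induct)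
  case (OrE \<Gamma> A B C)
  show ?case
    by (rule NJ.OrE[OF OrE.IH(1) OrE.IH(2) OrE.IH(3)]) (use OrE.prems in auto)
next
  case (ImpI A \<Gamma> B)
  show ?case
    by (rule NJ.ImpI, rule ImpI.IH) (use ImpI.prems in auto)
next
  case (AndI \<Gamma> A B)
  then show ?case by (simp add: NJ.AndI)
next
  case (AndE1 \<Gamma> A B)
  then show ?case using NJ.AndE1 by blast
next
  case (AndE2 \<Gamma> A B)
  then show ?case using NJ.AndE2 by blast
next
  case (ImpE \<Gamma> A B)
  then show ?case using NJ.ImpE by blast
next
  case (BotE \<Gamma> A)
  then show ?case by (simp add: NJ.BotE)
qed (auto intro: NJ.Assm NJ.OrI1 NJ.OrI2)

lemma NJ_cut: "NJ \<Gamma> A \<Longrightarrow> NJ (insert A \<Gamma>) C \<Longrightarrow> NJ \<Gamma> C"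
  by (rule NJ.ImpE[OF NJ.ImpI])

text \<open>
  A context refutes a block relative to \<open>C\<close> when it proves the
  \<open>T\<close>-formulae and each \<open>F\<close>-formula would yield \<open>C\<close>; the
  \<open>F\<close>-formulae thus act as a disjunctive goal without forming their disjunction. In a
  branching \<open>F\<close>-rule and in the rule for \<open>T (Imp A B)\<close>, one child is used
  in the context extended by \<open>A\<close>, and the result supplies the hypothesis on \<open>F
  A\<close> for the other child. In the rule for \<open>F (Imp A B)\<close> the goal changes from
  \<open>C\<close> to \<open>B\<close>, which is why the \<open>F\<close>-formulae must be dropped.
\<close>

lemma refutable_imp_NJ:
  "refutable \<Pi> \<Longrightarrow> (\<And>A. T A \<in> \<Pi> \<Longrightarrow> NJ \<Gamma> A) \<Longrightarrow> (\<And>B. F B \<in> \<Pi> \<Longrightarrow> NJ (insert B \<Gamma>) C) \<Longrightarrow> NJ \<Gamma> C"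
proof (induction arbitrary: \<Gamma> C rule: refutable_induct)
  case (closed \<Pi>)
  then show ?case unfolding closed_block_def by (blast intro: NJ_cut NJ.BotE)
next
  case (TAnd A B \<Pi>)
  show ?case
    by (rule TAnd.IH) (use TAnd.prems TAnd.hyps in \<open>auto intro: NJ.AndE1 NJ.AndE2\<close>)
next
  case (FOr A B \<Pi>)
  have "NJ (insert D \<Gamma>) C" if "NJ (insert D \<Gamma>) (Or A B)" for D
    using that by (rule NJ_cut) (rule NJ_weakening[OF FOr.prems(2)[OF FOr.hyps]], blast)
  then have "NJ (insert A \<Gamma>) C" "NJ (insert B \<Gamma>) C"
    by (auto intro: NJ.OrI1 NJ.OrI2 NJ.Assm)
  with FOr.prems show ?case by - (rule FOr.IH, auto)
next
  case (TOr A B \<Pi>)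
  note T = NJ_weakening[OF TOr.prems(1)] and F = NJ_weakening[OF TOr.prems(2)]
  have "NJ (insert A \<Gamma>) C"
    by (rule TOr.IH(1)) (auto intro: NJ.Assm T F)
  moreover have "NJ (insert B \<Gamma>) C"
    by (rule TOr.IH(2)) (auto intro: NJ.Assm T F)
  ultimately show ?case by (rule NJ.OrE[OF TOr.prems(1)[OF TOr.hyps]])
next
  case (FAnd A B \<Pi>)
  note T = NJ_weakening[OF FAnd.prems(1)] and F = NJ_weakening[OF FAnd.prems(2)]
  have "NJ (insert B (insert A \<Gamma>)) (And A B)" by (auto intro: NJ.AndI NJ.Assm)
  moreover have "NJ (insert (And A B) (insert B (insert A \<Gamma>))) C"
    by (rule F[OF FAnd.hyps]) blast
  ultimately have "NJ (insert B (insert A \<Gamma>)) C" by (rule NJ_cut)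
  then have "NJ (insert A \<Gamma>) C"
    by - (rule FAnd.IH(2), auto intro: T F)
  then show ?case
    by - (rule FAnd.IH(1), auto intro: T F)
next
  case (TImp A B \<Pi>)
  note T = NJ_weakening[OF TImp.prems(1)] and F = NJ_weakening[OF TImp.prems(2)]
  have "NJ (insert A \<Gamma>) (Imp A B)" by (rule T[OF TImp.hyps]) blast
  then have "NJ (insert A \<Gamma>) B" by (rule NJ.ImpE) (simp add: NJ.Assm)
  then have "NJ (insert A \<Gamma>) C"
    by - (rule TImp.IH(2), auto intro: T F)
  then show ?case
    by - (rule TImp.IH(1), auto intro: T F)
next
  case (FImp A B \<Pi>)
  have "NJ (insert A \<Gamma>) B"
    by (rule FImp.IH) (auto simp: T_part_def intro: NJ.Assm NJ_weakening[OF FImp.prems(1)])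
  then have "NJ \<Gamma> (Imp A B)" by (rule NJ.ImpI)
  then show ?case using FImp.prems(2)[OF FImp.hyps] by (rule NJ_cut)
qed

theorem IPL_provable_iff_refutable: "IPL_provable A \<longleftrightarrow> refutable {F A}"
proof
  assume N: "IPL_provable A"
  show "refutable {F A}"
  proof (rule ccontr)
    assume "\<not> refutable {F A}"
    with BTi_complete[of "{F A}"] obtain R V and w :: "block \<times> block"
      where w: "kripke_model R V" "\<not> forces R V w A" by auto
    have "forces R V w A"
      by (rule NJ_sound[OF w(1) N[unfolded IPL_provable_def]]) simp
    with w(2) show False by blast
  qed
next
  assume "refutable {F A}"
  then have "NJ {} A" by (rule refutable_imp_NJ) (auto intro: NJ.Assm)
  then show "IPL_provable A" by (simp add: IPL_provable_def)
qed


section \<open>Every number is a code\<close>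

text \<open>
  The codes of the five formula constructors exhaust \<open>0\<close> and the residue classes modulo
  \<open>4\<close> of the positive numbers. Surjectivity turns quantifiers over formulae into
  quantifiers over numbers.
\<close>

lemma form_code_surj: obtains A where "form_code A = n"
proof -
  have "\<exists>A. form_code A = n"
  proof (induction n rule: less_induct)
    case (less n)
    have pair: "\<exists>A B. prod_encode (form_code A, form_code B) = q" if "q < n" for q
    proof -
      obtain a b where q: "q = prod_encode (a, b)" by (metis prod_decode_inverse surj_pair)
      then have "a < n" "b < n"
        using le_prod_encode_1[of a b] le_prod_encode_2[of b a] that by simp_all
      then show ?thesis using less.IH q by metis
    qed
    show ?case
    proof (cases n)
      case 0
      then show ?thesis by (intro exI[of _ Bot]) simp
    next
      case (Suc m)
      define q where "q = m div 4"
      have "m = 4 * q + m mod 4" by (simp add: q_def)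
      moreover have "m mod 4 < 4" by simp
      ultimately consider "n = 4 * q + 1" | "n = 4 * q + 2" | "n = 4 * q + 3" | "n = 4 * q + 4"
        unfolding Suc by linarith
      then show ?thesis
      proof cases
        case 1
        then show ?thesis by (intro exI[of _ "Var q"]) simp
      next
        case 2
        with pair[of q] obtain A B where "prod_encode (form_code A, form_code B) = q" by auto
        with 2 show ?thesis by (intro exI[of _ "And A B"]) simp
      next
        case 3
        with pair[of q] obtain A B where "prod_encode (form_code A, form_code B) = q" by auto
        with 3 show ?thesis by (intro exI[of _ "Or A B"]) simp
      next
        case 4
        with pair[of q] obtain A B where "prod_encode (form_code A, form_code B) = q" by auto
        with 4 show ?thesis by (intro exI[of _ "Imp A B"]) simp
      qed
    qed
  qed
  then show thesis using that by blast
qed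

lemma sform_code_surj: obtains \<phi> where "sform_code \<phi> = n"
proof -
  obtain A where "form_code A = n div 2" by (rule form_code_surj)
  then have "sform_code (if even n then T A else F A) = n" by simp
  then show thesis by (rule that)
qed

lemma inj_sform_code: "inj sform_code"
  by (simp add: inj_def)

lemma set_decode_block_code: "finite \<Pi> \<Longrightarrow> set_decode (block_code \<Pi>) = sform_code ` \<Pi>"
  by (simp add: block_code_def)

lemma in_set_decode_block_code [simp]:
  "finite \<Pi> \<Longrightarrow> sform_code \<phi> \<in> set_decode (block_code \<Pi>) \<longleftrightarrow> \<phi> \<in> \<Pi>"
  by (auto simp: set_decode_block_code)

lemma block_code_surj: obtains \<Pi> where "finite \<Pi>" "block_code \<Pi> = b"
proof
  show "finite (sform_code -` set_decode b)"
    by (simp add: finite_vimageI inj_sform_code)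
  have "surj sform_code" by (metis sform_code_surj surj_def)
  then show "block_code (sform_code -` set_decode b) = b"
    by (simp add: block_code_def surj_image_vimage_eq)
qed

lemma block_code_inject: "finite \<Pi> \<Longrightarrow> finite \<Sigma> \<Longrightarrow> block_code \<Pi> = block_code \<Sigma> \<longleftrightarrow> \<Pi> = \<Sigma>"
  using inj_on_block_code by (auto dest: inj_onD)

lemma less_if_in_set_decode: "k \<in> set_decode b \<Longrightarrow> k < b"
proof -
  assume "k \<in> set_decode b"
  then have "b div 2 ^ k \<noteq> 0" by (auto simp: set_decode_def intro: ccontr)
  then have "2 ^ k \<le> b" by (metis div_less not_less)
  then show "k < b" using less_exp[of k] by linarith
qed

lemma set_decode_subset_iff: "set_decode b \<subseteq> {..<m} \<longleftrightarrow> b < 2 ^ m"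
proof
  assume "set_decode b \<subseteq> {..<m}"
  then have "set_encode (set_decode b) \<le> (\<Sum>k<m. 2 ^ k)"
    unfolding set_encode_def by (intro sum_mono2) auto
  also have "\<dots> < 2 ^ m" by (induction m) simp_all
  finally show "b < 2 ^ m" by simp
next
  assume "b < 2 ^ m"
  show "set_decode b \<subseteq> {..<m}"
  proof
    fix k assume "k \<in> set_decode b"
    then have "b div 2 ^ k \<noteq> 0" by (auto simp: set_decode_def intro: ccontr)
    then have "2 ^ k \<le> b" by (metis div_less not_less)
    with \<open>b < 2 ^ m\<close> have "(2 :: nat) ^ k < 2 ^ m" by linarith
    then show "k \<in> {..<m}" by simp
  qed
qed

lemma block_code_less_iff:
  "finite \<Pi> \<Longrightarrow> block_code \<Pi> < 2 ^ (2 * n) \<longleftrightarrow> \<Pi> \<subseteq> universe n"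
  unfolding set_decode_subset_iff[symmetric] by (auto simp: set_decode_block_code universe_def)

lemma block_in_universe_of_code: "finite \<Pi> \<Longrightarrow> \<Pi> \<subseteq> universe (block_code \<Pi>)"
  using less_if_in_set_decode[of _ "block_code \<Pi>"] by (force simp: universe_def set_decode_block_code)


section \<open>Refutability as an arithmetical relation\<close>

text \<open>
  The numerical counterparts of the operations on blocks and of the constructors are total, and
  commute with the coding. They are constants of their own, so that a formula about codes can be
  rewritten into one about blocks by \<open>connective_codes\<close> and \<open>set_codes\<close>.
\<close>

definition insert_code :: "nat \<Rightarrow> nat \<Rightarrow> nat" where
  "insert_code k b = set_encode (insert k (set_decode b))"

definition remove_code :: "nat \<Rightarrow> nat \<Rightarrow> nat" where
  "remove_code k b = set_encode (set_decode b - {k})"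

definition T_part_code :: "nat \<Rightarrow> nat" where
  "T_part_code b = set_encode {k \<in> set_decode b. even k}"

definition T_code :: "nat \<Rightarrow> nat" where "T_code a = 2 * a"
definition F_code :: "nat \<Rightarrow> nat" where "F_code a = 2 * a + 1"
definition Var_code :: "nat \<Rightarrow> nat" where "Var_code p = 4 * p + 1"
definition And_code :: "nat \<Rightarrow> nat \<Rightarrow> nat" where "And_code a b = 4 * prod_encode (a, b) + 2"
definition Or_code :: "nat \<Rightarrow> nat \<Rightarrow> nat" where "Or_code a b = 4 * prod_encode (a, b) + 3"
definition Imp_code :: "nat \<Rightarrow> nat \<Rightarrow> nat" where "Imp_code a b = 4 * prod_encode (a, b) + 4"

lemma connective_codes:
  "T_code (form_code A) = sform_code (T A)" "F_code (form_code A) = sform_code (F A)"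
  "Var_code p = form_code (Var p)"
  "And_code (form_code A) (form_code B) = form_code (And A B)"
  "Or_code (form_code A) (form_code B) = form_code (Or A B)"
  "Imp_code (form_code A) (form_code B) = form_code (Imp A B)"
  by (simp_all add: T_code_def F_code_def Var_code_def And_code_def Or_code_def Imp_code_def)

lemma set_codes:
  assumes "finite \<Pi>"
  shows "insert_code (sform_code \<phi>) (block_code \<Pi>) = block_code (insert \<phi> \<Pi>)"
    and "remove_code (sform_code \<phi>) (block_code \<Pi>) = block_code (\<Pi> - {\<phi>})"
    and "T_part_code (block_code \<Pi>) = block_code (T_part \<Pi>)"
proof -
  show "insert_code (sform_code \<phi>) (block_code \<Pi>) = block_code (insert \<phi> \<Pi>)"
    using assms by (simp add: insert_code_def set_decode_block_code) (simp add: block_code_def)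
  show "remove_code (sform_code \<phi>) (block_code \<Pi>) = block_code (\<Pi> - {\<phi>})"
    using assms by (simp add: remove_code_def set_decode_block_code)
      (simp add: block_code_def image_set_diff inj_sform_code)
  have "{k \<in> sform_code ` \<Pi>. even k} = sform_code ` T_part \<Pi>"
  proof -
    have "even (sform_code \<phi>) \<longleftrightarrow> (\<exists>A. \<phi> = T A)" for \<phi> by (cases \<phi>) auto
    then show ?thesis unfolding T_part_def by blast
  qed
  with assms show "T_part_code (block_code \<Pi>) = block_code (T_part \<Pi>)"
    by (simp add: T_part_code_def set_decode_block_code) (simp add: block_code_def)
qed

lemma computable_sign_codes:
  assumes "computable n f"
  shows "computable n (\<lambda>xs. T_code (f xs))" "computable n (\<lambda>xs. F_code (f xs))"
    "computable n (\<lambda>xs. Var_code (f xs))"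
  unfolding T_code_def F_code_def Var_code_def by (intro computable_intros assms)+

lemma computable_connective_codes:
  assumes "computable n f" "computable n g"
  shows "computable n (\<lambda>xs. And_code (f xs) (g xs))" "computable n (\<lambda>xs. Or_code (f xs) (g xs))"
    "computable n (\<lambda>xs. Imp_code (f xs) (g xs))"
  unfolding And_code_def Or_code_def Imp_code_def by (intro computable_intros assms)+

lemma computable_insert_code:
  "computable n f \<Longrightarrow> computable n g \<Longrightarrow> computable n (\<lambda>xs. insert_code (f xs) (g xs))"
proof (rule computable_compose2[of insert_code])
  have "computable (Suc (Suc 0)) (\<lambda>xs. set_encode {j. j < Suc (hd xs + hd (tl xs)) \<and>
      (j = hd xs \<or> j \<in> set_decode (hd (tl xs)))})"
    by (intro computable_intros)
  moreover have "{j. j < Suc (k + b) \<and> (j = k \<or> j \<in> set_decode b)} = insert k (set_decode b)" for k b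
    by (auto dest: less_if_in_set_decode)
  ultimately show "computable (Suc (Suc 0)) (\<lambda>xs. insert_code (hd xs) (hd (tl xs)))"
    by (simp add: insert_code_def)
qed

lemma computable_remove_code:
  "computable n f \<Longrightarrow> computable n g \<Longrightarrow> computable n (\<lambda>xs. remove_code (f xs) (g xs))"
proof (rule computable_compose2[of remove_code])
  have "computable (Suc (Suc 0)) (\<lambda>xs. set_encode {j. j < hd (tl xs) \<and>
      (j \<noteq> hd xs \<and> j \<in> set_decode (hd (tl xs)))})"
    by (intro computable_intros)
  moreover have "{j. j < b \<and> (j \<noteq> k \<and> j \<in> set_decode b)} = set_decode b - {k}" for k b
    by (auto dest: less_if_in_set_decode)
  ultimately show "computable (Suc (Suc 0)) (\<lambda>xs. remove_code (hd xs) (hd (tl xs)))"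
    by (simp add: remove_code_def)
qed

lemma computable_T_part_code:
  "computable n f \<Longrightarrow> computable n (\<lambda>xs. T_part_code (f xs))"
proof (rule computable_compose1[of T_part_code])
  have "computable (Suc 0) (\<lambda>xs. set_encode {j. j < hd xs \<and> (j \<in> set_decode (hd xs) \<and> even j)})"
    by (intro computable_intros)
  moreover have "{j. j < b \<and> (j \<in> set_decode b \<and> even j)} = {j \<in> set_decode b. even j}" for b
    by (auto dest: less_if_in_set_decode)
  ultimately show "computable (Suc 0) (\<lambda>xs. T_part_code (hd xs))"
    by (simp add: T_part_code_def)
qed

text \<open>
  Some rule with components \<open>a\<close> and \<open>c\<close> applies to the block
  \<open>b\<close> with all children in the set of blocks \<open>x\<close>.
\<close>

definition rule_justified :: "nat \<Rightarrow> nat \<Rightarrow> nat \<Rightarrow> nat \<Rightarrow> bool" where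
  "rule_justified x b a c \<longleftrightarrow>
      T_code (And_code a c) \<in> set_decode b \<and>
        insert_code (T_code a) (insert_code (T_code c) (remove_code (T_code (And_code a c)) b)) \<in> set_decode x
    \<or> F_code (Or_code a c) \<in> set_decode b \<and>
        insert_code (F_code a) (insert_code (F_code c) (remove_code (F_code (Or_code a c)) b)) \<in> set_decode x
    \<or> T_code (Or_code a c) \<in> set_decode b \<and>
        insert_code (T_code a) (remove_code (T_code (Or_code a c)) b) \<in> set_decode x \<and>
        insert_code (T_code c) (remove_code (T_code (Or_code a c)) b) \<in> set_decode x
    \<or> F_code (And_code a c) \<in> set_decode b \<and>
        insert_code (F_code a) (remove_code (F_code (And_code a c)) b) \<in> set_decode x \<and>
        insert_code (F_code c) (remove_code (F_code (And_code a c)) b) \<in> set_decode x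
    \<or> T_code (Imp_code a c) \<in> set_decode b \<and>
        insert_code (F_code a) b \<in> set_decode x \<and>
        insert_code (T_code c) (remove_code (T_code (Imp_code a c)) b) \<in> set_decode x
    \<or> F_code (Imp_code a c) \<in> set_decode b \<and>
        insert_code (T_code a) (insert_code (F_code c) (T_part_code b)) \<in> set_decode x"

text \<open>
  The formula \<open>Bot\<close> has code \<open>0\<close>.
\<close>

definition justified :: "nat \<Rightarrow> nat \<Rightarrow> bool" where
  "justified x b \<longleftrightarrow>
    (\<exists>p<b. T_code (Var_code p) \<in> set_decode b \<and> F_code (Var_code p) \<in> set_decode b)
    \<or> T_code 0 \<in> set_decode b
    \<or> (\<exists>a<b. \<exists>c<b. rule_justified x b a c)"

lemma computable_rel_justified:
  "computable n f \<Longrightarrow> computable n g \<Longrightarrow> computable_rel n (\<lambda>xs. justified (f xs) (g xs))"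
proof (rule computable_rel_compose2[of justified])
  show "computable_rel (Suc (Suc 0)) (\<lambda>xs. justified (hd xs) (hd (tl xs)))"
    unfolding justified_def rule_justified_def
    by (intro computable_intros computable_sign_codes computable_connective_codes computable_insert_code
      computable_remove_code computable_T_part_code)
qed

lemma rule_justified_iff:
  assumes "finite \<Pi>"
  shows "rule_justified x (block_code \<Pi>) (form_code A) (form_code B) \<longleftrightarrow>
    (\<exists>cs. BTi_instance A B \<Pi> cs \<and> (\<forall>c \<in> set cs. block_code c \<in> set_decode x))"
proof -
  have "finite (T_part \<Pi>)" using assms by (simp add: T_part_def)
  with assms show ?thesis
    unfolding rule_justified_def BTi_instance_def
    by (simp add: connective_codes set_codes conj_disj_distribR ex_disj_distrib
      del: form_code.simps sform_code.simps)
qed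

lemma component_less_code:
  "a < T_code (And_code a c)" "c < T_code (And_code a c)"
  "a < F_code (And_code a c)" "c < F_code (And_code a c)"
  "a < T_code (Or_code a c)" "c < T_code (Or_code a c)"
  "a < F_code (Or_code a c)" "c < F_code (Or_code a c)"
  "a < T_code (Imp_code a c)" "c < T_code (Imp_code a c)"
  "a < F_code (Imp_code a c)" "c < F_code (Imp_code a c)"
  using le_prod_encode_1[of a c] le_prod_encode_2[of c a]
  by (simp_all add: T_code_def F_code_def And_code_def Or_code_def Imp_code_def)

lemma rule_justified_bounds: "rule_justified x b a c \<Longrightarrow> a < b \<and> c < b"
  unfolding rule_justified_def
  by (elim disjE conjE; drule less_if_in_set_decode)
    (blast intro: less_trans component_less_code)+

lemma justified_iff:
  assumes \<Pi>: "finite \<Pi>"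
  shows "justified x (block_code \<Pi>) \<longleftrightarrow>
    closed_block \<Pi> \<or> (\<exists>cs. BTi_rule \<Pi> cs \<and> (\<forall>c \<in> set cs. block_code c \<in> set_decode x))"
proof -
  let ?b = "block_code \<Pi>"
  have "p < ?b" if "T_code (Var_code p) \<in> set_decode ?b" for p
    using less_if_in_set_decode[OF that] by (simp add: T_code_def Var_code_def)
  then have "(\<exists>p<?b. T_code (Var_code p) \<in> set_decode ?b \<and> F_code (Var_code p) \<in> set_decode ?b)
      \<longleftrightarrow> (\<exists>p. T (Var p) \<in> \<Pi> \<and> F (Var p) \<in> \<Pi>)"
    using \<Pi> by (auto simp: connective_codes simp del: form_code.simps sform_code.simps)
  moreover have "T_code 0 \<in> set_decode ?b \<longleftrightarrow> T Bot \<in> \<Pi>"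
    using in_set_decode_block_code[OF \<Pi>, of "T Bot"] by (simp add: T_code_def)
  moreover have "(\<exists>a<?b. \<exists>c<?b. rule_justified x ?b a c)
      \<longleftrightarrow> (\<exists>A B. rule_justified x ?b (form_code A) (form_code B))"
    by (metis rule_justified_bounds form_code_surj)
  then have "(\<exists>a<?b. \<exists>c<?b. rule_justified x ?b a c)
      \<longleftrightarrow> (\<exists>cs. BTi_rule \<Pi> cs \<and> (\<forall>c \<in> set cs. block_code c \<in> set_decode x))"
    unfolding rule_justified_iff[OF \<Pi>] BTi_rule_iff by blast
  ultimately show ?thesis unfolding justified_def closed_block_def by simp
qed

text \<open>
  Membership in every set of blocks that is closed under the rules, where only sets of blocks over
  \<open>universe n\<close> are considered. The block \<open>n\<close> lies in that universe itself,
  since an exponent in the binary expansion of \<open>n\<close> is smaller than \<open>n\<close>.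
\<close>

definition refutable_code :: "nat \<Rightarrow> bool" where
  "refutable_code n \<longleftrightarrow>
    (\<forall>x<2 ^ 2 ^ (2 * n). (\<forall>b<2 ^ (2 * n). justified x b \<longrightarrow> b \<in> set_decode x) \<longrightarrow> n \<in> set_decode x)"

lemma computable_rel_refutable_code:
  "computable n f \<Longrightarrow> computable_rel n (\<lambda>xs. refutable_code (f xs))"
proof (rule computable_rel_compose1[of refutable_code])
  show "computable_rel (Suc 0) (\<lambda>xs. refutable_code (hd xs))"
    unfolding refutable_code_def by (intro computable_intros computable_rel_justified)
qed

text \<open>
  From left to right, the set to instantiate is that of all refutable blocks over the universe. From
  right to left, induction on the refutation puts every block of it into a given closed set; the
  induction stays inside the universe by \<open>BTi_rule_universe\<close>.
\<close>

lemma refutable_code_iff: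
  assumes \<Pi>: "finite \<Pi>"
  shows "refutable_code (block_code \<Pi>) \<longleftrightarrow> refutable \<Pi>"
proof
  let ?n = "block_code \<Pi>"
  note fin = finite_subset[OF _ finite_universe]
  {
    assume code: "refutable_code ?n"
    define X where "X = block_code ` {\<Sigma>. \<Sigma> \<subseteq> universe ?n \<and> refutable \<Sigma>}"
    have in_X: "block_code \<Sigma> \<in> X \<longleftrightarrow> \<Sigma> \<subseteq> universe ?n \<and> refutable \<Sigma>" if "finite \<Sigma>" for \<Sigma>
    proof
      assume "block_code \<Sigma> \<in> X"
      then obtain \<Sigma>' where \<Sigma>': "block_code \<Sigma> = block_code \<Sigma>'" "\<Sigma>' \<in> {\<Sigma>. \<Sigma> \<subseteq> universe ?n \<and> refutable \<Sigma>}"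
        unfolding X_def by (rule imageE)
      then have "finite \<Sigma>'" by (intro fin[of _ ?n]) simp
      with \<Sigma>' that have "\<Sigma> = \<Sigma>'" by (simp add: block_code_inject)
      with \<Sigma>'(2) show "\<Sigma> \<subseteq> universe ?n \<and> refutable \<Sigma>" by simp
    qed (simp add: X_def)
    have X: "X \<subseteq> {..<2 ^ (2 * ?n)}" unfolding X_def using block_code_less_iff fin by auto
    then have "finite X" by (rule finite_subset) simp
    then have dec: "set_decode (set_encode X) = X" by simp
    have small: "set_encode X < 2 ^ 2 ^ (2 * ?n)"
      using X unfolding set_decode_subset_iff[symmetric] dec .
    have closed: "b \<in> set_decode (set_encode X)"
      if b: "b < 2 ^ (2 * ?n)" "justified (set_encode X) b" for b
    proof -
      obtain \<Sigma> where \<Sigma>: "finite \<Sigma>" "block_code \<Sigma> = b" by (rule block_code_surj)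
      with b block_code_less_iff have sub: "\<Sigma> \<subseteq> universe ?n" by blast
      have "refutable \<Sigma>"
        using b(2) unfolding \<Sigma>(2)[symmetric] justified_iff[OF \<Sigma>(1)] dec
      proof (elim disjE exE conjE)
        fix cs assume cs: "BTi_rule \<Sigma> cs" "\<forall>c \<in> set cs. block_code c \<in> X"
        have "refutable c" if "c \<in> set cs" for c
          using in_X[OF fin[OF BTi_rule_universe[OF cs(1) sub that]]] bspec[OF cs(2) that] by simp
        then show ?thesis by (intro refutable_rule[OF cs(1)] ballI)
      qed (rule refutable_closed)
      with sub show ?thesis using in_X[OF \<Sigma>(1)] unfolding dec \<Sigma>(2) by simp
    qed
    have "?n \<in> set_decode (set_encode X)"
      by (rule code[unfolded refutable_code_def, rule_format, OF small closed])
    then have "?n \<in> X" unfolding dec .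
    then show "refutable \<Pi>" using in_X[OF \<Pi>] by simp
  }
  {
    assume ref: "refutable \<Pi>"
    have "?n \<in> set_decode x"
      if x: "\<forall>b<2 ^ (2 * ?n). justified x b \<longrightarrow> b \<in> set_decode x" for x
    proof -
      have step: "block_code \<Sigma> \<in> set_decode x" if "\<Sigma> \<subseteq> universe ?n" "justified x (block_code \<Sigma>)" for \<Sigma>
        using x that block_code_less_iff[OF fin[OF that(1)]] by blast
      have "refutable \<Sigma> \<Longrightarrow> \<Sigma> \<subseteq> universe ?n \<Longrightarrow> block_code \<Sigma> \<in> set_decode x" for \<Sigma>
      proof (induction rule: refutable_rule_induct)
        case (closed \<Sigma>)
        then have "justified x (block_code \<Sigma>)" by (simp add: justified_iff[OF fin])
        with closed.prems show ?case by (rule step)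
      next
        case (rule \<Sigma> cs)
        have "\<forall>c \<in> set cs. block_code c \<in> set_decode x"
        proof
          fix c assume c: "c \<in> set cs"
          from bspec[OF rule.IH c] BTi_rule_universe[OF rule.hyps(1) rule.prems c]
          show "block_code c \<in> set_decode x" by simp
        qed
        then have "justified x (block_code \<Sigma>)"
          unfolding justified_iff[OF fin[OF rule.prems]] using rule.hyps(1) by blast
        with rule.prems show ?case by (rule step)
      qed
      from this[OF ref block_in_universe_of_code[OF \<Pi>]] show ?thesis .
    qed
    then show "refutable_code ?n" unfolding refutable_code_def by simp
  }
qed


section \<open>Codes of sequents\<close>

text \<open>
  At most one summand is different from \<open>0\<close>: the sum describes the second component of
  the pair coded by \<open>m - 1\<close>. The empty list is its own tail, as both are coded by
  \<open>0\<close>.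
\<close>

definition tl_code :: "nat \<Rightarrow> nat" where
  "tl_code m = (\<Sum>y<m. if \<exists>k<m. m = Suc (prod_encode (k, y)) then y else 0)"

definition drop_code :: "nat \<Rightarrow> nat \<Rightarrow> nat" where
  "drop_code i m = rec_nat m (\<lambda>_ r. tl_code r) i"

text \<open>
  The bound \<open>m\<close> suffices for each quantifier because the code of a list bounds its
  length, its entries and the codes of its proper suffixes (\<open>drop_eq_Cons_bounds\<close>).
\<close>

definition member_code :: "nat \<Rightarrow> nat \<Rightarrow> bool" where
  "member_code k m \<longleftrightarrow> (\<exists>i<m. \<exists>y<m. drop_code i m = Suc (prod_encode (k, y)))"

definition sorted_code :: "nat \<Rightarrow> bool" where
  "sorted_code m \<longleftrightarrow> (\<forall>i<m. \<forall>k<m. \<forall>l<m. \<forall>y<m.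
     drop_code i m = Suc (prod_encode (k, Suc (prod_encode (l, y)))) \<longrightarrow> k \<le> l)"

lemma computable_tl_code: "computable n f \<Longrightarrow> computable n (\<lambda>xs. tl_code (f xs))"
proof (rule computable_compose1[of tl_code])
  show "computable (Suc 0) (\<lambda>xs. tl_code (hd xs))"
    unfolding tl_code_def by (intro computable_intros)
qed

lemma computable_drop_code:
  "computable n f \<Longrightarrow> computable n g \<Longrightarrow> computable n (\<lambda>xs. drop_code (f xs) (g xs))"
  unfolding drop_code_def by (intro computable_rec_nat computable_tl_code computable_arg1)

lemma computable_rel_member_code:
  "computable n f \<Longrightarrow> computable n g \<Longrightarrow> computable_rel n (\<lambda>xs. member_code (f xs) (g xs))"
proof (rule computable_rel_compose2[of member_code])
  show "computable_rel (Suc (Suc 0)) (\<lambda>xs. member_code (hd xs) (hd (tl xs)))"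
    unfolding member_code_def by (intro computable_intros computable_drop_code)
qed

lemma computable_rel_sorted_code:
  "computable n f \<Longrightarrow> computable_rel n (\<lambda>xs. sorted_code (f xs))"
proof (rule computable_rel_compose1[of sorted_code])
  show "computable_rel (Suc 0) (\<lambda>xs. sorted_code (hd xs))"
    unfolding sorted_code_def by (intro computable_intros computable_drop_code)
qed

lemma tl_code_list_encode: "tl_code (list_encode xs) = list_encode (tl xs)"
proof (cases xs)
  case (Cons k ys)
  let ?y = "list_encode ys" and ?m = "list_encode xs"
  have "k < ?m" "?y < ?m"
    using le_prod_encode_1[of k ?y] le_prod_encode_2[of ?y k] by (simp_all add: Cons)
  have "(\<exists>j<?m. ?m = Suc (prod_encode (j, y))) \<longleftrightarrow> y = ?y" for y
    using \<open>k < ?m\<close> by (auto simp: Cons)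
  then have "tl_code ?m = (\<Sum>y<?m. if y = ?y then y else 0)"
    unfolding tl_code_def by simp
  also have "\<dots> = ?y" using \<open>?y < ?m\<close> by simp
  finally show ?thesis by (simp add: Cons)
qed (simp add: tl_code_def)

lemma drop_code_list_encode: "drop_code i (list_encode xs) = list_encode (drop i xs)"
  by (induction i) (simp_all add: drop_code_def tl_code_list_encode drop_Suc tl_drop)

lemma list_encode_drop_le: "list_encode (drop i xs) \<le> list_encode xs"
proof (induction xs arbitrary: i)
  case (Cons k ys)
  have "list_encode ys \<le> list_encode (k # ys)"
    using le_prod_encode_2[of "list_encode ys" k] by simp
  with Cons.IH show ?case by (cases i) (auto intro: order_trans)
qed simp

lemma length_le_list_encode: "length xs \<le> list_encode xs"
proof (induction xs)
  case (Cons k ys)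
  then show ?case using le_prod_encode_2[of "list_encode ys" k] by simp
qed simp

lemma list_encode_eq_Cons_iff:
  "list_encode xs = Suc (prod_encode (k, y)) \<longleftrightarrow> (\<exists>ys. xs = k # ys \<and> y = list_encode ys)"
  by (cases xs) auto

lemma drop_eq_Cons_bounds:
  assumes "drop i xs = k # ys"
  shows "i < list_encode xs" "k < list_encode xs" "list_encode ys < list_encode xs"
proof -
  have "i < length xs" using assms by (cases "i < length xs") auto
  then show "i < list_encode xs" using length_le_list_encode[of xs] by linarith
  have "Suc (prod_encode (k, list_encode ys)) \<le> list_encode xs"
    using list_encode_drop_le[of i xs] by (simp add: assms)
  then show "k < list_encode xs" "list_encode ys < list_encode xs"
    using le_prod_encode_1[of k "list_encode ys"] le_prod_encode_2[of "list_encode ys" k] by linarith+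
qed

lemma member_code_list_encode: "member_code k (list_encode xs) \<longleftrightarrow> k \<in> set xs"
proof
  assume "member_code k (list_encode xs)"
  then obtain i ys where "drop i xs = k # ys"
    unfolding member_code_def drop_code_list_encode list_encode_eq_Cons_iff by blast
  then show "k \<in> set xs" by (metis in_set_dropD list.set_intros(1))
next
  assume "k \<in> set xs"
  then obtain i where "i < length xs" "drop i xs = k # drop (Suc i) xs"
    by (metis Cons_nth_drop_Suc in_set_conv_nth)
  then show "member_code k (list_encode xs)"
    unfolding member_code_def drop_code_list_encode list_encode_eq_Cons_iff
    using drop_eq_Cons_bounds by blast
qed

lemma sorted_code_list_encode: "sorted_code (list_encode xs) \<longleftrightarrow> sorted xs"
proof -
  have "sorted_code (list_encode xs) \<longleftrightarrow> (\<forall>i k l ys. drop i xs = k # l # ys \<longrightarrow> k \<le> l)"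
  proof
    assume sc: "sorted_code (list_encode xs)"
    show "\<forall>i k l ys. drop i xs = k # l # ys \<longrightarrow> k \<le> l"
    proof (intro allI impI)
      fix i k l ys assume d: "drop i xs = k # l # ys"
      then have "drop (Suc i) xs = l # ys" by (metis drop_Suc tl_drop list.sel(3))
      from drop_eq_Cons_bounds[OF d] drop_eq_Cons_bounds[OF this] sc d show "k \<le> l"
        unfolding sorted_code_def drop_code_list_encode by (metis list_encode.simps(2))
    qed
  next
    assume "\<forall>i k l ys. drop i xs = k # l # ys \<longrightarrow> k \<le> l"
    then show "sorted_code (list_encode xs)"
      unfolding sorted_code_def drop_code_list_encode
      by (metis list_encode.simps(2) list_encode_eq_Cons_iff)
  qed
  also have "\<dots> \<longleftrightarrow> sorted xs"
  proof
    assume d: "\<forall>i k l ys. drop i xs = k # l # ys \<longrightarrow> k \<le> l"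
    show "sorted xs"
      unfolding sorted_iff_nth_Suc
    proof (intro allI impI)
      fix i assume "Suc i < length xs"
      then have "drop i xs = xs ! i # xs ! Suc i # drop (Suc (Suc i)) xs"
        by (metis Cons_nth_drop_Suc Suc_lessD)
      with d show "xs ! i \<le> xs ! Suc i" by blast
    qed
  next
    assume "sorted xs"
    then have "sorted (drop i xs)" for i by (rule sorted_wrt_drop)
    then show "\<forall>i k l ys. drop i xs = k # l # ys \<longrightarrow> k \<le> l"
      by (metis list.set_intros(1) sorted_simps(2))
  qed
  finally show ?thesis .
qed

text \<open>
  Only sorted lists represent multisets. As every number is the code of a formula, each sorted list
  does.
\<close>

lemma sorted_code_iff: "sorted_code m \<longleftrightarrow> (\<exists>\<Gamma>. mset_code \<Gamma> = m)"
proof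
  assume sc: "sorted_code m"
  obtain xs where m: "m = list_encode xs" by (metis list_decode_inverse)
  obtain decode where "\<And>k. form_code (decode k) = k" by (metis form_code_surj)
  then have "image_mset form_code (image_mset decode (mset xs)) = mset xs"
    by (simp add: image_mset.compositionality comp_def)
  then have "mset_code (image_mset decode (mset xs)) = m"
    using sc by (simp add: mset_code_def m sorted_code_list_encode sorted_sort_id)
  then show "\<exists>\<Gamma>. mset_code \<Gamma> = m" by blast
qed (auto simp: mset_code_def sorted_code_list_encode)

lemma member_code_mset_code: "member_code k (mset_code \<Gamma>) \<longleftrightarrow> k \<in> form_code ` set_mset \<Gamma>"
  by (simp add: mset_code_def member_code_list_encode)

text \<open>
  The code of the block of a sequent, computed from the codes of its two sides. An entry of a list
  is less than the code of the list, so \<open>2 * (\<gamma> + \<delta>)\<close> exceeds all signed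
  formulae that occur.
\<close>

definition sequent_block_code :: "nat \<Rightarrow> nat \<Rightarrow> nat" where
  "sequent_block_code \<gamma> \<delta> = set_encode {s. s < 2 * (\<gamma> + \<delta>) \<and>
     ((\<exists>k<\<gamma>. s = T_code k \<and> member_code k \<gamma>) \<or> (\<exists>k<\<delta>. s = F_code k \<and> member_code k \<delta>))}"

lemma computable_sequent_block_code:
  "computable n f \<Longrightarrow> computable n g \<Longrightarrow> computable n (\<lambda>xs. sequent_block_code (f xs) (g xs))"
proof (rule computable_compose2[of sequent_block_code])
  show "computable (Suc (Suc 0)) (\<lambda>xs. sequent_block_code (hd xs) (hd (tl xs)))"
    unfolding sequent_block_code_def
    by (intro computable_intros computable_rel_member_code computable_sign_codes)
qed

lemma sequent_block_code_eq:
  "sequent_block_code (mset_code \<Gamma>) (mset_code \<Delta>) = block_code (sequent_block \<Gamma> \<Delta>)"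
proof -
  have lt: "k < m" if "member_code k m" for k m
  proof -
    obtain xs where "m = list_encode xs" by (metis list_decode_inverse)
    with that drop_eq_Cons_bounds(2) show ?thesis
      unfolding member_code_def by (metis drop_code_list_encode list_encode_eq_Cons_iff)
  qed
  have "{s. s < 2 * (\<gamma> + \<delta>) \<and>
     ((\<exists>k<\<gamma>. s = T_code k \<and> member_code k \<gamma>) \<or> (\<exists>k<\<delta>. s = F_code k \<and> member_code k \<delta>))}
    = T_code ` {k. member_code k \<gamma>} \<union> F_code ` {k. member_code k \<delta>}" for \<gamma> \<delta>
    by (auto simp: T_code_def F_code_def dest: lt)
  moreover have "T_code ` {k. member_code k (mset_code \<Gamma>)} \<union> F_code ` {k. member_code k (mset_code \<Delta>)}
    = sform_code ` sequent_block \<Gamma> \<Delta>"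
    unfolding member_code_mset_code sequent_block_def
    by (auto simp: image_Un image_image connective_codes simp del: sform_code.simps)
  ultimately show ?thesis by (simp add: sequent_block_code_def block_code_def)
qed

lemma sequent_code_iff:
  "(\<exists>\<gamma><Suc n. \<exists>\<delta><Suc n. n = prod_encode (\<gamma>, \<delta>) \<and> sorted_code \<gamma> \<and> sorted_code \<delta> \<and>
      refutable_code (sequent_block_code \<gamma> \<delta>))
    \<longleftrightarrow> (\<exists>\<Gamma> \<Delta>. n = sequent_code \<Gamma> \<Delta> \<and> G3Ti \<Gamma> \<Delta>)"
proof -
  have "refutable_code (sequent_block_code (mset_code \<Gamma>) (mset_code \<Delta>)) \<longleftrightarrow> G3Ti \<Gamma> \<Delta>" for \<Gamma> \<Delta>
    by (simp add: sequent_block_code_eq refutable_code_iff G3Ti_iff_refutable) (simp add: sequent_block_def refutable_code_iff)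
  moreover have "\<gamma> < Suc (prod_encode (\<gamma>, \<delta>))" "\<delta> < Suc (prod_encode (\<gamma>, \<delta>))" for \<gamma> \<delta>
    using le_prod_encode_1 le_prod_encode_2 by (simp_all add: less_Suc_eq_le)
  ultimately show ?thesis unfolding sorted_code_iff sequent_code_def by blast
qed


section \<open>Decidability\<close>

lemma decidable_set_if_computable_rel:
  assumes "computable_rel (Suc 0) (\<lambda>xs. P (hd xs))"
  shows "decidable_set {n. P n}"
  using assms unfolding computable_rel_def computable_def decidable_set_def
  by (auto simp: One_nat_def)

theorem corollary5p10:
  shows "decidable_set {block_code \<Pi> | \<Pi>. finite \<Pi> \<and> refutable \<Pi>}
    \<and> decidable_set {sequent_code \<Gamma> \<Delta> | \<Gamma> \<Delta>. G3Ti \<Gamma> \<Delta>}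
    \<and> decidable_set {form_code A | A. IPL_provable A}"
proof (intro conjI)
  have "refutable_code n \<longleftrightarrow> (\<exists>\<Pi>. n = block_code \<Pi> \<and> finite \<Pi> \<and> refutable \<Pi>)" for n
    by (metis block_code_surj refutable_code_iff)
  moreover have "decidable_set {n. refutable_code n}"
    by (intro decidable_set_if_computable_rel computable_rel_refutable_code computable_arg0)
  ultimately show "decidable_set {block_code \<Pi> | \<Pi>. finite \<Pi> \<and> refutable \<Pi>}" by simp
next
  have "decidable_set {n. \<exists>\<gamma><Suc n. \<exists>\<delta><Suc n. n = prod_encode (\<gamma>, \<delta>) \<and> sorted_code \<gamma> \<and>
      sorted_code \<delta> \<and> refutable_code (sequent_block_code \<gamma> \<delta>)}"
    by (intro decidable_set_if_computable_rel computable_intros computable_rel_sorted_code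
      computable_rel_refutable_code computable_sequent_block_code)
  then show "decidable_set {sequent_code \<Gamma> \<Delta> | \<Gamma> \<Delta>. G3Ti \<Gamma> \<Delta>}"
    unfolding sequent_code_iff .
next
  \<comment> \<open>a block with a single element is coded by a power of two\<close>
  have "refutable_code (2 ^ F_code n) \<longleftrightarrow> (\<exists>A. n = form_code A \<and> IPL_provable A)" for n
  proof -
    obtain A where A: "n = form_code A" by (metis form_code_surj)
    then have "2 ^ F_code n = block_code {F A}"
      by (simp add: block_code_def set_encode_def F_code_def)
    with A show ?thesis by (simp add: refutable_code_iff IPL_provable_iff_refutable)
  qed
  moreover have "decidable_set {n. refutable_code (2 ^ F_code n)}"
    by (intro decidable_set_if_computable_rel computable_rel_refutable_code computable_intros
      computable_sign_codes)
  ultimately show "decidable_set {form_code A | A. IPL_provable A}" by simp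
qed

end
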